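(* Let $(R,\mathfrak m)$ be a commutative noetherian local ring, $I$ an ideal of $R$, and $\mathcal P$ the class of all $I$-generated $R$-modules. If $M$ is an injective $R$-module, then $$M\in\mathcal P\iff I_{\mathfrak p}\text{ is regular in }R_{\mathfrak p}\text{ for all }\mathfrak p\in\operatorname{Ass}(M).$$
   Context: An $R$-module $M$ is $I$-generated if there is an epimorphism $I^{(\Lambda)}\twoheadrightarrow M$ for some index set $\Lambda$ (where $I^{(\Lambda)}$ is the direct sum of copies of $I$). $I_{\mathfrak p}=IR_{\mathfrak p}$. An ideal is called regular if it contains a non-zero-divisor of the ring (for an ideal in a noetherian ring, equivalently its annihilator is zero). $\operatorname{Ass}(M)$ is the set of associated primes of $M$, i.e. prime ideals of the form $\operatorname{Ann}_R(x)$ with $x\in M$. *)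

theory Defs
  imports "HOL-Algebra.Module" "HOL-Algebra.Ring_Divisibility"
begin

section \<open>Modules\<close>

definition module_hom ::
    "('a, 'r) ring_scheme \<Rightarrow> ('a, 'b, 's) module_scheme \<Rightarrow> ('a, 'c, 't) module_scheme \<Rightarrow> ('b \<Rightarrow> 'c) set"
  where "module_hom R M N =
    {f \<in> carrier M \<rightarrow> carrier N.
       (\<forall>x \<in> carrier M. \<forall>y \<in> carrier M. f (x \<oplus>\<^bsub>M\<^esub> y) = f x \<oplus>\<^bsub>N\<^esub> f y) \<and>
       (\<forall>r \<in> carrier R. \<forall>x \<in> carrier M. f (r \<odot>\<^bsub>M\<^esub> x) = r \<odot>\<^bsub>N\<^esub> f x)}"

text \<open>Module records inherit the fields \<open>mult\<close> and \<open>one\<close> from ring records;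
  they play no role in the locale \<^locale>\<open>module\<close> and are left unspecified below.\<close>

definition ideal_module :: "('a, 'r) ring_scheme \<Rightarrow> 'a set \<Rightarrow> ('a, 'a) module"
  where "ideal_module R I =
    \<lparr>carrier = I, mult = undefined, one = undefined, zero = \<zero>\<^bsub>R\<^esub>, add = add R, smult = mult R\<rparr>"

text \<open>The direct sum of copies of \<open>N\<close> indexed by \<open>L\<close>.\<close>

definition direct_sum_copies ::
    "'l set \<Rightarrow> ('a, 'b, 's) module_scheme \<Rightarrow> ('a, 'l \<Rightarrow> 'b) module"
  where "direct_sum_copies L N =
    \<lparr>carrier = {x \<in> L \<rightarrow>\<^sub>E carrier N. finite {l \<in> L. x l \<noteq> \<zero>\<^bsub>N\<^esub>}},
     mult = undefined, one = undefined,
     zero = (\<lambda>l\<in>L. \<zero>\<^bsub>N\<^esub>),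
     add = (\<lambda>x y. \<lambda>l\<in>L. x l \<oplus>\<^bsub>N\<^esub> y l),
     smult = (\<lambda>r x. \<lambda>l\<in>L. r \<odot>\<^bsub>N\<^esub> x l)\<rparr>"

text \<open>A definition cannot quantify over all types, so index sets are taken from the type of
  all functions from \<open>R\<close> to \<open>M\<close>. This is no restriction:
  see \<open>generated_by_of_surjection\<close>.\<close>

definition generated_by ::
    "('a, 'r) ring_scheme \<Rightarrow> 'a set \<Rightarrow> ('a, 'm, 's) module_scheme \<Rightarrow> bool"
  where "generated_by R I M \<longleftrightarrow> module R M \<and>
    (\<exists>L :: ('a \<Rightarrow> 'm) set. \<exists>h \<in> module_hom R (direct_sum_copies L (ideal_module R I)) M.
       h ` carrier (direct_sum_copies L (ideal_module R I)) = carrier M)"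

text \<open>For the same reason the test modules live on one fixed type, which has room for copies of
  \<open>R\<close> and \<open>M\<close>. By Baer's criterion the lifting property then holds for test modules on
  arbitrary types: see \<open>injective_module_extends\<close>.\<close>

definition injective_module ::
    "('a, 'r) ring_scheme \<Rightarrow> ('a, 'm, 's) module_scheme \<Rightarrow> bool"
  where "injective_module R M \<longleftrightarrow> module R M \<and>
    (\<forall>(A :: ('a, 'a + 'm) module) (B :: ('a, 'a + 'm) module) f g.
       module R A \<and> module R B \<and>
       f \<in> module_hom R A B \<and> inj_on f (carrier A) \<and> g \<in> module_hom R A M \<longrightarrow>
       (\<exists>h \<in> module_hom R B M. \<forall>x \<in> carrier A. h (f x) = g x))"

definition annihilator :: "('a, 'r) ring_scheme \<Rightarrow> ('a, 'm, 's) module_scheme \<Rightarrow> 'm \<Rightarrow> 'a set"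
  where "annihilator R M x = {r \<in> carrier R. r \<odot>\<^bsub>M\<^esub> x = \<zero>\<^bsub>M\<^esub>}"

definition Ass :: "('a, 'r) ring_scheme \<Rightarrow> ('a, 'm, 's) module_scheme \<Rightarrow> 'a set set"
  where "Ass R M = {p. primeideal p R \<and> (\<exists>x \<in> carrier M. p = annihilator R M x)}"


section \<open>Local rings, regular ideals, localization\<close>

locale local_ring = cring R + maximalideal m R for R (structure) and m +
  assumes unique_maximal: "maximalideal n R \<Longrightarrow> n = m"

definition non_zero_divisor :: "('a, 'r) ring_scheme \<Rightarrow> 'a \<Rightarrow> bool"
  where "non_zero_divisor R x \<longleftrightarrow>
    x \<in> carrier R \<and> (\<forall>y \<in> carrier R. x \<otimes>\<^bsub>R\<^esub> y = \<zero>\<^bsub>R\<^esub> \<longrightarrow> y = \<zero>\<^bsub>R\<^esub>)"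

definition regular_ideal :: "('a, 'r) ring_scheme \<Rightarrow> 'a set \<Rightarrow> bool"
  where "regular_ideal R J \<longleftrightarrow> ideal J R \<and> (\<exists>x \<in> J. non_zero_divisor R x)"

definition frac_rel :: "('a, 'r) ring_scheme \<Rightarrow> 'a set \<Rightarrow> (('a \<times> 'a) \<times> ('a \<times> 'a)) set"
  where "frac_rel R S =
    {((a, s), (b, t)). a \<in> carrier R \<and> s \<in> S \<and> b \<in> carrier R \<and> t \<in> S \<and>
       (\<exists>u \<in> S. u \<otimes>\<^bsub>R\<^esub> (t \<otimes>\<^bsub>R\<^esub> a \<ominus>\<^bsub>R\<^esub> s \<otimes>\<^bsub>R\<^esub> b) = \<zero>\<^bsub>R\<^esub>)}"

definition frac :: "('a, 'r) ring_scheme \<Rightarrow> 'a set \<Rightarrow> 'a \<Rightarrow> 'a \<Rightarrow> ('a \<times> 'a) set"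
  where "frac R S a s = frac_rel R S `` {(a, s)}"

definition localization :: "('a, 'r) ring_scheme \<Rightarrow> 'a set \<Rightarrow> ('a \<times> 'a) set ring"
  where "localization R S =
    \<lparr>carrier = (carrier R \<times> S) // frac_rel R S,
     mult = (\<lambda>X Y. \<Union>(a, s) \<in> X. \<Union>(b, t) \<in> Y. frac R S (a \<otimes>\<^bsub>R\<^esub> b) (s \<otimes>\<^bsub>R\<^esub> t)),
     one = frac R S \<one>\<^bsub>R\<^esub> \<one>\<^bsub>R\<^esub>,
     zero = frac R S \<zero>\<^bsub>R\<^esub> \<one>\<^bsub>R\<^esub>,
     add = (\<lambda>X Y. \<Union>(a, s) \<in> X. \<Union>(b, t) \<in> Y.
              frac R S (t \<otimes>\<^bsub>R\<^esub> a \<oplus>\<^bsub>R\<^esub> s \<otimes>\<^bsub>R\<^esub> b) (s \<otimes>\<^bsub>R\<^esub> t))\<rparr>"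

definition localize_at :: "('a, 'r) ring_scheme \<Rightarrow> 'a set \<Rightarrow> ('a \<times> 'a) set ring"
  where "localize_at R p = localization R (carrier R - p)"

definition localize_ideal_at :: "('a, 'r) ring_scheme \<Rightarrow> 'a set \<Rightarrow> 'a set \<Rightarrow> ('a \<times> 'a) set set"
  where "localize_ideal_at R p I =
    genideal (localize_at R p) ((\<lambda>a. frac R (carrier R - p) a \<one>\<^bsub>R\<^esub>) ` I)"

section \<open>Independence of the chosen types\<close>

lemma module_homD:
  assumes "f \<in> module_hom R M N"
  shows "x \<in> carrier M \<Longrightarrow> f x \<in> carrier N"
    and "x \<in> carrier M \<Longrightarrow> y \<in> carrier M \<Longrightarrow> f (x \<oplus>\<^bsub>M\<^esub> y) = f x \<oplus>\<^bsub>N\<^esub> f y"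
    and "r \<in> carrier R \<Longrightarrow> x \<in> carrier M \<Longrightarrow> f (r \<odot>\<^bsub>M\<^esub> x) = r \<odot>\<^bsub>N\<^esub> f x"
  using assms unfolding module_hom_def by auto

lemma module_homI:
  assumes "\<And>x. x \<in> carrier M \<Longrightarrow> f x \<in> carrier N"
    and "\<And>x y. x \<in> carrier M \<Longrightarrow> y \<in> carrier M \<Longrightarrow> f (x \<oplus>\<^bsub>M\<^esub> y) = f x \<oplus>\<^bsub>N\<^esub> f y"
    and "\<And>r x. r \<in> carrier R \<Longrightarrow> x \<in> carrier M \<Longrightarrow> f (r \<odot>\<^bsub>M\<^esub> x) = r \<odot>\<^bsub>N\<^esub> f x"
  shows "f \<in> module_hom R M N"
  using assms unfolding module_hom_def by auto

lemma module_hom_zero: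
  assumes "module R M" "module R N" "f \<in> module_hom R M N"
  shows "f \<zero>\<^bsub>M\<^esub> = \<zero>\<^bsub>N\<^esub>"
proof -
  interpret M: module R M by fact
  interpret N: module R N by fact
  have "f (\<zero>\<^bsub>R\<^esub> \<odot>\<^bsub>M\<^esub> \<zero>\<^bsub>M\<^esub>) = \<zero>\<^bsub>R\<^esub> \<odot>\<^bsub>N\<^esub> f \<zero>\<^bsub>M\<^esub>"
    by (rule module_homD(3)[OF assms(3)]) auto
  moreover have "f \<zero>\<^bsub>M\<^esub> \<in> carrier N" by (rule module_homD(1)[OF assms(3)]) auto
  ultimately show ?thesis by (simp only: M.smult_l_null N.smult_l_null M.M.zero_closed)
qed

lemma ideal_module_module:
  assumes "cring R" "ideal I R"
  shows "module R (ideal_module R I)"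
proof -
  interpret cring R by fact
  interpret ideal I R by fact
  have sub: "\<And>x. x \<in> I \<Longrightarrow> x \<in> carrier R" by (rule a_Hcarr)
  show ?thesis
  proof (rule moduleI)
    show "abelian_group (ideal_module R I)"
    proof (rule abelian_groupI)
      fix x assume "x \<in> carrier (ideal_module R I)"
      then show "\<exists>y\<in>carrier (ideal_module R I). y \<oplus>\<^bsub>ideal_module R I\<^esub> x = \<zero>\<^bsub>ideal_module R I\<^esub>"
        using sub by (intro bexI[of _ "\<ominus>\<^bsub>R\<^esub> x"]) (auto simp: ideal_module_def l_neg)
    qed (auto simp: ideal_module_def sub a_ac)
  qed (auto simp: ideal_module_def sub I_l_closed l_distr r_distr m_assoc assms(1))
qed

lemma direct_sum_copies_module:
  assumes "module R N"
  shows "module R (direct_sum_copies L N)"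
proof -
  interpret N: module R N by fact
  let ?D = "direct_sum_copies L N"
  have fin: "finite {l \<in> L. g l \<noteq> \<zero>\<^bsub>N\<^esub>}"
    if "finite {l \<in> L. x l \<noteq> \<zero>\<^bsub>N\<^esub>}" "finite {l \<in> L. y l \<noteq> \<zero>\<^bsub>N\<^esub>}"
      and "\<And>l. l \<in> L \<Longrightarrow> x l = \<zero>\<^bsub>N\<^esub> \<Longrightarrow> y l = \<zero>\<^bsub>N\<^esub> \<Longrightarrow> g l = \<zero>\<^bsub>N\<^esub>" for x y g
    by (rule finite_subset[OF _ finite_UnI[OF that(1,2)]]) (use that(3) in auto)
  have mem: "g \<in> carrier ?D \<longleftrightarrow> g \<in> L \<rightarrow>\<^sub>E carrier N \<and> finite {l \<in> L. g l \<noteq> \<zero>\<^bsub>N\<^esub>}" for g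
    by (simp add: direct_sum_copies_def)
  have ops: "\<zero>\<^bsub>?D\<^esub> = (\<lambda>l\<in>L. \<zero>\<^bsub>N\<^esub>)" "x \<oplus>\<^bsub>?D\<^esub> y = (\<lambda>l\<in>L. x l \<oplus>\<^bsub>N\<^esub> y l)"
    "r \<odot>\<^bsub>?D\<^esub> x = (\<lambda>l\<in>L. r \<odot>\<^bsub>N\<^esub> x l)" for x y r
    by (simp_all add: direct_sum_copies_def)
  have val: "x l \<in> carrier N" if "x \<in> carrier ?D" "l \<in> L" for x l
    using that mem by auto
  have undef: "x l = undefined" if "x \<in> carrier ?D" "l \<notin> L" for x l
    using that mem by (auto simp: PiE_def extensional_def)
  note simps = val undef fun_eq_iff restrict_def ops
  show ?thesis
  proof (rule moduleI)
    show "cring R" ..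
    show "abelian_group ?D"
    proof (rule abelian_groupI)
      fix x y assume xy: "x \<in> carrier ?D" "y \<in> carrier ?D"
      have "finite {l \<in> L. (x \<oplus>\<^bsub>?D\<^esub> y) l \<noteq> \<zero>\<^bsub>N\<^esub>}"
        by (rule fin[of x y]) (use xy in \<open>auto simp: mem ops\<close>)
      then show "x \<oplus>\<^bsub>?D\<^esub> y \<in> carrier ?D"
        using xy val by (auto simp: mem ops)
    next
      show "\<zero>\<^bsub>?D\<^esub> \<in> carrier ?D" by (simp add: mem ops)
    next
      fix x y z assume "x \<in> carrier ?D" "y \<in> carrier ?D" "z \<in> carrier ?D"
      then show "x \<oplus>\<^bsub>?D\<^esub> y \<oplus>\<^bsub>?D\<^esub> z = x \<oplus>\<^bsub>?D\<^esub> (y \<oplus>\<^bsub>?D\<^esub> z)"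
        by (simp add: simps N.a_assoc)
    next
      fix x y assume "x \<in> carrier ?D" "y \<in> carrier ?D"
      then show "x \<oplus>\<^bsub>?D\<^esub> y = y \<oplus>\<^bsub>?D\<^esub> x"
        by (simp add: simps N.a_comm)
    next
      fix x assume x: "x \<in> carrier ?D"
      then show "\<zero>\<^bsub>?D\<^esub> \<oplus>\<^bsub>?D\<^esub> x = x"
        by (simp add: simps)
      have "finite {l \<in> L. (\<lambda>l\<in>L. \<ominus>\<^bsub>N\<^esub> x l) l \<noteq> \<zero>\<^bsub>N\<^esub>}"
        by (rule fin[of x x]) (use x in \<open>auto simp: mem\<close>)
      hence "(\<lambda>l\<in>L. \<ominus>\<^bsub>N\<^esub> x l) \<in> carrier ?D"
        using x val by (auto simp: mem)
      moreover have "(\<lambda>l\<in>L. \<ominus>\<^bsub>N\<^esub> x l) \<oplus>\<^bsub>?D\<^esub> x = \<zero>\<^bsub>?D\<^esub>"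
        using x by (simp add: simps N.M.l_neg)
      ultimately show "\<exists>y\<in>carrier ?D. y \<oplus>\<^bsub>?D\<^esub> x = \<zero>\<^bsub>?D\<^esub>" by blast
    qed
  next
    fix r x assume rx: "r \<in> carrier R" "x \<in> carrier ?D"
    have "finite {l \<in> L. (r \<odot>\<^bsub>?D\<^esub> x) l \<noteq> \<zero>\<^bsub>N\<^esub>}"
      by (rule fin[of x x]) (use rx in \<open>auto simp: mem ops\<close>)
    then show "r \<odot>\<^bsub>?D\<^esub> x \<in> carrier ?D"
      using rx val by (auto simp: mem ops)
  next
    fix r s x assume "r \<in> carrier R" "s \<in> carrier R" "x \<in> carrier ?D"
    then show "(r \<oplus>\<^bsub>R\<^esub> s) \<odot>\<^bsub>?D\<^esub> x = r \<odot>\<^bsub>?D\<^esub> x \<oplus>\<^bsub>?D\<^esub> s \<odot>\<^bsub>?D\<^esub> x"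
      "r \<otimes>\<^bsub>R\<^esub> s \<odot>\<^bsub>?D\<^esub> x = r \<odot>\<^bsub>?D\<^esub> (s \<odot>\<^bsub>?D\<^esub> x)"
      by (simp_all add: simps N.smult_l_distr N.smult_assoc1)
  next
    fix r x y assume "r \<in> carrier R" "x \<in> carrier ?D" "y \<in> carrier ?D"
    then show "r \<odot>\<^bsub>?D\<^esub> (x \<oplus>\<^bsub>?D\<^esub> y) = r \<odot>\<^bsub>?D\<^esub> x \<oplus>\<^bsub>?D\<^esub> r \<odot>\<^bsub>?D\<^esub> y"
      by (simp add: simps N.smult_r_distr)
  next
    fix x assume "x \<in> carrier ?D"
    then show "\<one>\<^bsub>R\<^esub> \<odot>\<^bsub>?D\<^esub> x = x"
      by (simp add: simps)
  qed
qed

lemma generated_by_of_surjection: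
  fixes L :: "'l set" and R :: "('a, 'r) ring_scheme" and M :: "('a, 'm, 's) module_scheme"
  assumes M: "module R M" and I: "ideal I R"
    and h: "h \<in> module_hom R (direct_sum_copies L (ideal_module R I)) M"
    and surj: "h ` carrier (direct_sum_copies L (ideal_module R I)) = carrier M"
  shows "generated_by R I M"
proof -
  interpret M: module R M by fact
  interpret I: ideal I R by fact
  define N where "N = ideal_module R I"
  have N: "module R N" unfolding N_def by (rule ideal_module_module[OF M.is_cring I])
  interpret N: module R N by fact
  let ?D = "direct_sum_copies L N"
  have D: "module R ?D" by (rule direct_sum_copies_module[OF N])
  note h = h[folded N_def] and surj = surj[folded N_def]
  define sing where "sing l a = (\<lambda>k\<in>L. if k = l then a else \<zero>\<^bsub>N\<^esub>)" for l a
  define comp where "comp l = (\<lambda>a\<in>carrier N. h (sing l a))" for l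
  define L' where "L' = comp ` L"
  define rep where "rep \<phi> = (SOME l. l \<in> L \<and> comp l = \<phi>)" for \<phi>
  have rep: "rep \<phi> \<in> L \<and> comp (rep \<phi>) = \<phi>" if "\<phi> \<in> L'" for \<phi>
    unfolding rep_def by (rule someI_ex) (use that in \<open>auto simp: L'_def\<close>)
  have rep_inj: "rep \<phi> = rep \<psi> \<longleftrightarrow> \<phi> = \<psi>" if "\<phi> \<in> L'" "\<psi> \<in> L'" for \<phi> \<psi>
    using rep that by metis
  let ?E = "direct_sum_copies L' N"
  have E: "module R ?E" by (rule direct_sum_copies_module[OF N])
  interpret E: module R ?E by fact
  interpret D: module R ?D by fact
  define ext where "ext y = (\<lambda>k\<in>L. if k \<in> rep ` L' then y (the_inv_into L' rep k) else \<zero>\<^bsub>N\<^esub>)"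
    for y :: "('a \<Rightarrow> 'm) \<Rightarrow> 'a"
  have inj: "inj_on rep L'" using rep_inj by (auto intro: inj_onI)
  have inv: "the_inv_into L' rep (rep \<phi>) = \<phi>" if "\<phi> \<in> L'" for \<phi>
    using the_inv_into_f_f[OF inj that] .
  have ext_D: "ext y \<in> carrier ?D" if y: "y \<in> carrier ?E" for y
  proof -
    have "{k \<in> L. ext y k \<noteq> \<zero>\<^bsub>N\<^esub>} \<subseteq> rep ` {\<phi> \<in> L'. y \<phi> \<noteq> \<zero>\<^bsub>N\<^esub>}"
      using inv by (auto simp: ext_def split: if_splits)
    hence "finite {k \<in> L. ext y k \<noteq> \<zero>\<^bsub>N\<^esub>}"
      by (rule finite_subset) (use y in \<open>auto simp: direct_sum_copies_def\<close>)
    moreover have "y \<phi> \<in> carrier N" if "\<phi> \<in> L'" for \<phi>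
      using y that by (auto simp: direct_sum_copies_def)
    hence "ext y \<in> L \<rightarrow>\<^sub>E carrier N"
      using inv by (auto simp: ext_def)
    ultimately show ?thesis by (simp add: direct_sum_copies_def)
  qed
  have ext_hom: "ext \<in> module_hom R ?E ?D"
  proof (rule module_homI)
    fix x y assume "x \<in> carrier ?E" "y \<in> carrier ?E"
    show "ext (x \<oplus>\<^bsub>?E\<^esub> y) = ext x \<oplus>\<^bsub>?D\<^esub> ext y"
      using inv by (auto simp: ext_def direct_sum_copies_def intro!: restrict_ext)
  next
    fix r x assume "r \<in> carrier R" "x \<in> carrier ?E"
    then show "ext (r \<odot>\<^bsub>?E\<^esub> x) = r \<odot>\<^bsub>?D\<^esub> ext x"
      using inv by (auto simp: ext_def direct_sum_copies_def intro!: restrict_ext)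
  qed (rule ext_D)
  define g where "g = h \<circ> ext"
  have g: "g \<in> module_hom R ?E M"
    by (rule module_homI) (auto simp: g_def module_homD[OF ext_hom] module_homD[OF h])
  have sing_D: "sing l a \<in> carrier ?D" if "a \<in> carrier N" for l a
  proof -
    have "finite {k \<in> L. sing l a k \<noteq> \<zero>\<^bsub>N\<^esub>}"
      by (rule finite_subset[of _ "{l}"]) (auto simp: sing_def)
    thus ?thesis using that by (auto simp: direct_sum_copies_def sing_def)
  qed
  have sing_im: "h (sing l a) \<in> g ` carrier ?E" if l: "l \<in> L" and a: "a \<in> carrier N" for l a
  proof -
    define \<phi> where "\<phi> = comp l"
    have \<phi>: "\<phi> \<in> L'" using l by (simp add: \<phi>_def L'_def)
    define y where "y = (\<lambda>\<psi>\<in>L'. if \<psi> = \<phi> then a else \<zero>\<^bsub>N\<^esub>)"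
    have "finite {k \<in> L'. y k \<noteq> \<zero>\<^bsub>N\<^esub>}"
      by (rule finite_subset[of _ "{\<phi>}"]) (auto simp: y_def)
    hence y: "y \<in> carrier ?E" using a by (auto simp: direct_sum_copies_def y_def)
    have "ext y = sing (rep \<phi>) a"
      using inv \<phi> by (auto simp: ext_def sing_def y_def intro!: restrict_ext)
    moreover have "h (sing (rep \<phi>) a) = h (sing l a)"
      using rep[OF \<phi>] a by (metis \<phi>_def comp_def restrict_apply')
    ultimately show ?thesis using y by (metis comp_apply g_def imageI)
  qed
  have add_im: "u \<oplus>\<^bsub>M\<^esub> v \<in> g ` carrier ?E" if "u \<in> g ` carrier ?E" "v \<in> g ` carrier ?E" for u v
    using that module_homD(2)[OF g] by (auto simp flip: module_homD(2)[OF g])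
  have "h x \<in> g ` carrier ?E"
    if "finite F" "x \<in> carrier ?D" "{l \<in> L. x l \<noteq> \<zero>\<^bsub>N\<^esub>} \<subseteq> F" for F x
    using that
  proof (induction F arbitrary: x)
    case empty
    have "x = \<zero>\<^bsub>?D\<^esub>"
      using empty by (intro extensionalityI[where A = L]) (auto simp: direct_sum_copies_def PiE_def)
    hence "h x = g \<zero>\<^bsub>?E\<^esub>" using module_hom_zero[OF D M h] module_hom_zero[OF E M g] by simp
    thus ?case by blast
  next
    case (insert l F)
    have xL: "x \<in> L \<rightarrow>\<^sub>E carrier N" and xf: "finite {l \<in> L. x l \<noteq> \<zero>\<^bsub>N\<^esub>}"
      using insert.prems by (auto simp: direct_sum_copies_def)
    show ?case
    proof (cases "l \<in> L")
      case False
      then show ?thesis using insert by (intro insert.IH) auto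
    next
      case l: True
      define x' where "x' = (\<lambda>k\<in>L. if k = l then \<zero>\<^bsub>N\<^esub> else x k)"
      have "finite {k \<in> L. x' k \<noteq> \<zero>\<^bsub>N\<^esub>}"
        by (rule finite_subset[OF _ xf]) (auto simp: x'_def)
      hence x': "x' \<in> carrier ?D" using xL by (auto simp: direct_sum_copies_def x'_def)
      have xl: "x l \<in> carrier N" using xL l by auto
      have "x = x' \<oplus>\<^bsub>?D\<^esub> sing l (x l)"
        using xL by (intro extensionalityI[where A = L])
          (auto simp: direct_sum_copies_def x'_def sing_def PiE_def Pi_def)
      hence "h x = h x' \<oplus>\<^bsub>M\<^esub> h (sing l (x l))"
        using module_homD(2)[OF h x' sing_D[OF xl]] by metis
      moreover have "h x' \<in> g ` carrier ?E"
        using insert.prems by (intro insert.IH x') (auto simp: x'_def)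
      ultimately show ?thesis using add_im sing_im[OF l xl] by simp
    qed
  qed
  hence "h ` carrier ?D \<subseteq> g ` carrier ?E"
    by (auto simp: direct_sum_copies_def)
  moreover have "g ` carrier ?E \<subseteq> carrier M" using module_homD(1)[OF g] by auto
  ultimately have "g ` carrier ?E = carrier M" using surj by auto
  thus ?thesis using g M unfolding generated_by_def N_def by blast
qed

lemma injective_module_ideal:
  fixes R :: "('a, 'r) ring_scheme" and M :: "('a, 'm, 's) module_scheme"
  assumes M: "injective_module R M" and J: "ideal J R"
    and \<phi>: "\<phi> \<in> module_hom R (ideal_module R J) M"
  shows "\<exists>z \<in> carrier M. \<forall>r \<in> J. \<phi> r = r \<odot>\<^bsub>M\<^esub> z"
proof -
  interpret M: module R M using M by (simp add: injective_module_def)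
  define T :: "'a set \<Rightarrow> ('a, 'a + 'm) module" where "T K =
    \<lparr>carrier = Inl ` K, mult = undefined, one = undefined, zero = Inl \<zero>\<^bsub>R\<^esub>,
     add = (\<lambda>x y. Inl (projl x \<oplus>\<^bsub>R\<^esub> projl y)), smult = (\<lambda>r x. Inl (r \<otimes>\<^bsub>R\<^esub> projl x))\<rparr>"
    for K
  have T: "module R (T K)" if K: "ideal K R" for K
  proof -
    interpret ideal K R by fact
    have sub: "\<And>x. x \<in> K \<Longrightarrow> x \<in> carrier R" by (rule a_Hcarr)
    show ?thesis
    proof (rule moduleI)
      show "abelian_group (T K)"
      proof (rule abelian_groupI)
        fix x :: "'a + 'm" assume "x \<in> carrier (T K)"
        then obtain a where a: "a \<in> K" "x = Inl a" by (auto simp: T_def)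
        then show "\<exists>y\<in>carrier (T K). y \<oplus>\<^bsub>T K\<^esub> x = \<zero>\<^bsub>T K\<^esub>"
          using sub by (intro bexI[of _ "Inl (\<ominus>\<^bsub>R\<^esub> a)"]) (auto simp: T_def M.R.l_neg)
      qed (auto simp: T_def sub M.R.a_ac)
    qed (auto simp: T_def sub I_l_closed M.R.l_distr M.R.r_distr M.R.m_assoc M.is_cring)
  qed
  have sub: "\<And>x. x \<in> J \<Longrightarrow> x \<in> carrier R" using J by (rule ideal.Icarr)
  have "id \<in> module_hom R (T J) (T (carrier R))"
    by (rule module_homI) (auto simp: T_def sub)
  moreover have "\<phi> \<circ> projl \<in> module_hom R (T J) M"
    using module_homD[OF \<phi>] by (intro module_homI) (auto simp: T_def ideal_module_def)
  ultimately have "\<exists>h \<in> module_hom R (T (carrier R)) M.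
      \<forall>x \<in> carrier (T J). h (id x) = (\<phi> \<circ> projl) x"
    using M T[OF J] T[OF M.R.oneideal] unfolding injective_module_def by (metis inj_on_id)
  then obtain h where h: "h \<in> module_hom R (T (carrier R)) M"
    and ext: "\<And>x. x \<in> J \<Longrightarrow> h (Inl x) = \<phi> x"
    by (auto simp: T_def)
  have "\<phi> r = r \<odot>\<^bsub>M\<^esub> h (Inl \<one>\<^bsub>R\<^esub>)" if "r \<in> J" for r
    using module_homD(3)[OF h, of r "Inl \<one>\<^bsub>R\<^esub>"] that sub ext by (auto simp: T_def)
  moreover have "h (Inl \<one>\<^bsub>R\<^esub>) \<in> carrier M"
    using module_homD(1)[OF h, of "Inl \<one>\<^bsub>R\<^esub>"] by (auto simp: T_def)
  ultimately show ?thesis by blast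
qed

lemma injective_module_extends:
  fixes A :: "('a, 'u, 'v) module_scheme" and B :: "('a, 'w, 'x) module_scheme"
  assumes M: "injective_module R M" and A: "module R A" and B: "module R B"
    and f: "f \<in> module_hom R A B" and inj: "inj_on f (carrier A)"
    and g: "g \<in> module_hom R A M"
  shows "\<exists>h \<in> module_hom R B M. \<forall>x \<in> carrier A. h (f x) = g x"
proof -
  have M': "module R M" using M by (simp add: injective_module_def)
  interpret M: module R M by fact
  interpret A: module R A by fact
  interpret B: module R B by fact
  define G0 where "G0 = (\<lambda>x. (f x, g x)) ` carrier A"
  define P where "P G \<longleftrightarrow> G0 \<subseteq> G \<and> G \<subseteq> carrier B \<times> carrier M \<and>
    (\<forall>x y x' y'. (x, y) \<in> G \<longrightarrow> (x', y') \<in> G \<longrightarrow> (x \<oplus>\<^bsub>B\<^esub> x', y \<oplus>\<^bsub>M\<^esub> y') \<in> G) \<and>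
    (\<forall>r x y. r \<in> carrier R \<longrightarrow> (x, y) \<in> G \<longrightarrow> (r \<odot>\<^bsub>B\<^esub> x, r \<odot>\<^bsub>M\<^esub> y) \<in> G) \<and>
    (\<forall>y. (\<zero>\<^bsub>B\<^esub>, y) \<in> G \<longrightarrow> y = \<zero>\<^bsub>M\<^esub>)" for G
  have f0: "f \<zero>\<^bsub>A\<^esub> = \<zero>\<^bsub>B\<^esub>" by (rule module_hom_zero[OF A B f])
  have g0: "g \<zero>\<^bsub>A\<^esub> = \<zero>\<^bsub>M\<^esub>" by (rule module_hom_zero[OF A M' g])
  have PD1: "G0 \<subseteq> G" and PD2: "G \<subseteq> carrier B \<times> carrier M"
    and PD3: "\<And>x y x' y'. (x, y) \<in> G \<Longrightarrow> (x', y') \<in> G \<Longrightarrow> (x \<oplus>\<^bsub>B\<^esub> x', y \<oplus>\<^bsub>M\<^esub> y') \<in> G"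
    and PD4: "\<And>r x y. r \<in> carrier R \<Longrightarrow> (x, y) \<in> G \<Longrightarrow> (r \<odot>\<^bsub>B\<^esub> x, r \<odot>\<^bsub>M\<^esub> y) \<in> G"
    and PD5: "\<And>y. (\<zero>\<^bsub>B\<^esub>, y) \<in> G \<Longrightarrow> y = \<zero>\<^bsub>M\<^esub>" if "P G" for G
    using that unfolding P_def by simp_all
  have P0: "P G0"
    unfolding P_def
  proof (intro conjI allI impI)
    show "G0 \<subseteq> carrier B \<times> carrier M"
      using module_homD(1)[OF f] module_homD(1)[OF g] by (auto simp: G0_def)
  next
    fix x y x' y' assume "(x, y) \<in> G0" "(x', y') \<in> G0"
    then obtain a a' where "a \<in> carrier A" "a' \<in> carrier A" "x = f a" "y = g a" "x' = f a'" "y' = g a'"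
      by (auto simp: G0_def)
    then show "(x \<oplus>\<^bsub>B\<^esub> x', y \<oplus>\<^bsub>M\<^esub> y') \<in> G0"
      unfolding G0_def by (intro image_eqI[of _ _ "a \<oplus>\<^bsub>A\<^esub> a'"]) (auto simp: module_homD[OF f] module_homD[OF g])
  next
    fix r x y assume r: "r \<in> carrier R" and "(x, y) \<in> G0"
    then obtain a where "a \<in> carrier A" "x = f a" "y = g a"
      by (auto simp: G0_def)
    then show "(r \<odot>\<^bsub>B\<^esub> x, r \<odot>\<^bsub>M\<^esub> y) \<in> G0"
      using r unfolding G0_def
      by (intro image_eqI[of _ _ "r \<odot>\<^bsub>A\<^esub> a"]) (auto simp: module_homD[OF f] module_homD[OF g])
  next
    fix y assume "(\<zero>\<^bsub>B\<^esub>, y) \<in> G0"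
    then obtain a where "a \<in> carrier A" "f a = f \<zero>\<^bsub>A\<^esub>" "y = g a" by (auto simp: G0_def f0)
    then show "y = \<zero>\<^bsub>M\<^esub>" using inj g0 by (metis A.M.zero_closed inj_onD)
  qed simp
  have "\<exists>G\<in>{G. P G}. \<forall>X\<in>{G. P G}. G \<subseteq> X \<longrightarrow> X = G"
  proof (rule subset_Zorn_nonempty)
    show "{G. P G} \<noteq> {}" using P0 by blast
  next
    fix C assume ne: "C \<noteq> {}" and ch: "subset.chain {G. P G} C"
    have PC: "\<And>G. G \<in> C \<Longrightarrow> P G" and lin: "\<And>G H. G \<in> C \<Longrightarrow> H \<in> C \<Longrightarrow> G \<subseteq> H \<or> H \<subseteq> G"
      using ch by (auto simp: subset_chain_def)
    have "P (\<Union>C)"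
      unfolding P_def
    proof (intro conjI allI impI)
      obtain G where "G \<in> C" using ne by blast
      then show "G0 \<subseteq> \<Union>C" using PD1[OF PC] by blast
      show "\<Union>C \<subseteq> carrier B \<times> carrier M" using PD2[OF PC] by (rule Union_least)
    next
      fix x y x' y' assume "(x, y) \<in> \<Union>C" "(x', y') \<in> \<Union>C"
      then obtain G H where GH: "G \<in> C" "(x, y) \<in> G" "H \<in> C" "(x', y') \<in> H" by auto
      then obtain K where K: "K \<in> C" "(x, y) \<in> K" "(x', y') \<in> K" using lin[of G H] by auto
      then show "(x \<oplus>\<^bsub>B\<^esub> x', y \<oplus>\<^bsub>M\<^esub> y') \<in> \<Union>C"
        using PD3[OF PC[OF K(1)] K(2,3)] by auto
    next
      fix r x y assume "r \<in> carrier R" "(x, y) \<in> \<Union>C"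
      then show "(r \<odot>\<^bsub>B\<^esub> x, r \<odot>\<^bsub>M\<^esub> y) \<in> \<Union>C" by (elim UnionE) (rule UnionI, assumption, rule PD4[OF PC])
    next
      fix y assume "(\<zero>\<^bsub>B\<^esub>, y) \<in> \<Union>C"
      then show "y = \<zero>\<^bsub>M\<^esub>" using PD5[OF PC] by auto
    qed
    then show "\<Union>C \<in> {G. P G}" by simp
  qed
  then obtain G where PG: "P G" and max: "\<And>X. P X \<Longrightarrow> G \<subseteq> X \<Longrightarrow> X = G" by blast
  note G0 = PD1[OF PG] and Ga = PD3[OF PG] and Gs = PD4[OF PG] and Gz = PD5[OF PG]
  have Gc: "x \<in> carrier B \<and> y \<in> carrier M" if "(x, y) \<in> G" for x y
    using PD2[OF PG] that by auto
  have G00: "(\<zero>\<^bsub>B\<^esub>, \<zero>\<^bsub>M\<^esub>) \<in> G"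
    using G0 f0 g0 A.M.zero_closed unfolding G0_def by force
  have Gneg: "(\<ominus>\<^bsub>B\<^esub> x, \<ominus>\<^bsub>M\<^esub> y) \<in> G" if "(x, y) \<in> G" for x y
    using Gs[of "\<ominus>\<^bsub>R\<^esub> \<one>\<^bsub>R\<^esub>" x y] that Gc[OF that] by (simp add: B.smult_l_minus M.smult_l_minus)
  have Gu: "y = y'" if "(x, y) \<in> G" "(x, y') \<in> G" for x y y'
  proof -
    have "(x \<oplus>\<^bsub>B\<^esub> \<ominus>\<^bsub>B\<^esub> x, y \<oplus>\<^bsub>M\<^esub> \<ominus>\<^bsub>M\<^esub> y') \<in> G" using Ga[OF that(1) Gneg[OF that(2)]] .
    hence "y \<oplus>\<^bsub>M\<^esub> \<ominus>\<^bsub>M\<^esub> y' = \<zero>\<^bsub>M\<^esub>" using Gz Gc[OF that(1)] by (simp add: B.M.r_neg)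
    thus ?thesis using M.M.add.inv_solve_right[of "\<zero>\<^bsub>M\<^esub>" y "y'"] Gc[OF that(1)] Gc[OF that(2)]
      by simp
  qed
  have total: "\<exists>y. (b, y) \<in> G" if b: "b \<in> carrier B" for b
  proof -
    define J where "J = {r \<in> carrier R. \<exists>y. (r \<odot>\<^bsub>B\<^esub> b, y) \<in> G}"
    have J: "ideal J R"
    proof (rule idealI)
      show "ring R" ..
      show "subgroup J (add_monoid R)"
      proof (rule M.R.add.subgroupI)
        show "J \<subseteq> carrier R" by (auto simp: J_def)
        show "J \<noteq> {}" using G00 b by (auto simp: J_def intro!: exI[of _ "\<zero>\<^bsub>R\<^esub>"])
      next
        fix r assume "r \<in> J"
        then show "\<ominus>\<^bsub>R\<^esub> r \<in> J" using Gneg b by (fastforce simp: J_def B.smult_l_minus)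
      next
        fix r s assume "r \<in> J" "s \<in> J"
        then show "r \<oplus>\<^bsub>R\<^esub> s \<in> J" using Ga b by (fastforce simp: J_def B.smult_l_distr)
      qed
    next
      fix r s assume *: "r \<in> J" "s \<in> carrier R"
      then show "s \<otimes>\<^bsub>R\<^esub> r \<in> J" using Gs b by (fastforce simp: J_def B.smult_assoc1)
      then show "r \<otimes>\<^bsub>R\<^esub> s \<in> J" using * by (simp add: J_def M.R.m_comm)
    qed
    define \<phi> where "\<phi> r = (THE y. (r \<odot>\<^bsub>B\<^esub> b, y) \<in> G)" for r
    have \<phi>: "(r \<odot>\<^bsub>B\<^esub> b, \<phi> r) \<in> G" if "r \<in> J" for r
      using that Gu unfolding \<phi>_def J_def by (auto intro: theI2)
    have \<phi>_eq: "\<phi> r = y" if "(r \<odot>\<^bsub>B\<^esub> b, y) \<in> G" for r y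
      unfolding \<phi>_def using that Gu by blast
    have Jc: "\<And>r. r \<in> J \<Longrightarrow> r \<in> carrier R" by (simp add: J_def)
    have "\<phi> \<in> module_hom R (ideal_module R J) M"
    proof (rule module_homI)
      fix r assume "r \<in> carrier (ideal_module R J)"
      then show "\<phi> r \<in> carrier M" using \<phi> Gc by (auto simp: ideal_module_def)
    next
      fix r s assume "r \<in> carrier (ideal_module R J)" "s \<in> carrier (ideal_module R J)"
      then show "\<phi> (r \<oplus>\<^bsub>ideal_module R J\<^esub> s) = \<phi> r \<oplus>\<^bsub>M\<^esub> \<phi> s"
        using Ga[OF \<phi> \<phi>, of r s] b Jc by (intro \<phi>_eq) (auto simp: ideal_module_def B.smult_l_distr)
    next
      fix s r assume "s \<in> carrier R" "r \<in> carrier (ideal_module R J)"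
      then show "\<phi> (s \<odot>\<^bsub>ideal_module R J\<^esub> r) = s \<odot>\<^bsub>M\<^esub> \<phi> r"
        using Gs[OF _ \<phi>, of s r] b Jc by (intro \<phi>_eq) (auto simp: ideal_module_def B.smult_assoc1)
    qed
    then obtain z where z: "z \<in> carrier M" and \<phi>z: "\<And>r. r \<in> J \<Longrightarrow> \<phi> r = r \<odot>\<^bsub>M\<^esub> z"
      using injective_module_ideal[OF M J] by blast
    have Gz': "(r \<odot>\<^bsub>B\<^esub> b, r \<odot>\<^bsub>M\<^esub> z) \<in> G" if "r \<in> J" for r using \<phi>[OF that] \<phi>z[OF that] by simp
    define X where "X = {(x \<oplus>\<^bsub>B\<^esub> r \<odot>\<^bsub>B\<^esub> b, y \<oplus>\<^bsub>M\<^esub> r \<odot>\<^bsub>M\<^esub> z) | x y r. (x, y) \<in> G \<and> r \<in> carrier R}"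
    have GX: "G \<subseteq> X"
    proof clarify
      fix x y assume "(x, y) \<in> G"
      then show "(x, y) \<in> X" using Gc b z unfolding X_def
        by (intro CollectI exI[of _ x] exI[of _ y] exI[of _ "\<zero>\<^bsub>R\<^esub>"]) auto
    qed
    have "P X"
      unfolding P_def
    proof (intro conjI allI impI)
      show "G0 \<subseteq> X" using G0 GX by blast
      show "X \<subseteq> carrier B \<times> carrier M" using Gc b z by (auto simp: X_def)
    next
      fix u v u' v' assume "(u, v) \<in> X" "(u', v') \<in> X"
      then obtain x y r x' y' r' where *: "(x, y) \<in> G" "r \<in> carrier R" "(x', y') \<in> G" "r' \<in> carrier R"
        "u = x \<oplus>\<^bsub>B\<^esub> r \<odot>\<^bsub>B\<^esub> b" "v = y \<oplus>\<^bsub>M\<^esub> r \<odot>\<^bsub>M\<^esub> z" "u' = x' \<oplus>\<^bsub>B\<^esub> r' \<odot>\<^bsub>B\<^esub> b" "v' = y' \<oplus>\<^bsub>M\<^esub> r' \<odot>\<^bsub>M\<^esub> z"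
        unfolding X_def by blast
      have "u \<oplus>\<^bsub>B\<^esub> u' = (x \<oplus>\<^bsub>B\<^esub> x') \<oplus>\<^bsub>B\<^esub> (r \<oplus>\<^bsub>R\<^esub> r') \<odot>\<^bsub>B\<^esub> b"
        using * Gc[OF *(1)] Gc[OF *(3)] b by (simp add: B.smult_l_distr B.M.a_ac)
      moreover have "v \<oplus>\<^bsub>M\<^esub> v' = (y \<oplus>\<^bsub>M\<^esub> y') \<oplus>\<^bsub>M\<^esub> (r \<oplus>\<^bsub>R\<^esub> r') \<odot>\<^bsub>M\<^esub> z"
        using * Gc[OF *(1)] Gc[OF *(3)] z by (simp add: M.smult_l_distr M.M.a_ac)
      ultimately show "(u \<oplus>\<^bsub>B\<^esub> u', v \<oplus>\<^bsub>M\<^esub> v') \<in> X"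
        unfolding X_def using Ga[OF *(1,3)] * by blast
    next
      fix s u v assume s: "s \<in> carrier R" and "(u, v) \<in> X"
      then obtain x y r where *: "(x, y) \<in> G" "r \<in> carrier R"
        "u = x \<oplus>\<^bsub>B\<^esub> r \<odot>\<^bsub>B\<^esub> b" "v = y \<oplus>\<^bsub>M\<^esub> r \<odot>\<^bsub>M\<^esub> z"
        unfolding X_def by blast
      have "s \<odot>\<^bsub>B\<^esub> u = s \<odot>\<^bsub>B\<^esub> x \<oplus>\<^bsub>B\<^esub> (s \<otimes>\<^bsub>R\<^esub> r) \<odot>\<^bsub>B\<^esub> b"
        using * s Gc[OF *(1)] b by (simp add: B.smult_r_distr B.smult_assoc1)
      moreover have "s \<odot>\<^bsub>M\<^esub> v = s \<odot>\<^bsub>M\<^esub> y \<oplus>\<^bsub>M\<^esub> (s \<otimes>\<^bsub>R\<^esub> r) \<odot>\<^bsub>M\<^esub> z"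
        using * s Gc[OF *(1)] z by (simp add: M.smult_r_distr M.smult_assoc1)
      moreover have "s \<otimes>\<^bsub>R\<^esub> r \<in> carrier R" using s * by simp
      ultimately show "(s \<odot>\<^bsub>B\<^esub> u, s \<odot>\<^bsub>M\<^esub> v) \<in> X"
        unfolding X_def using Gs[OF s *(1)] by blast
    next
      fix v assume "(\<zero>\<^bsub>B\<^esub>, v) \<in> X"
      then obtain x y r where *: "(x, y) \<in> G" "r \<in> carrier R"
        "x \<oplus>\<^bsub>B\<^esub> r \<odot>\<^bsub>B\<^esub> b = \<zero>\<^bsub>B\<^esub>" "v = y \<oplus>\<^bsub>M\<^esub> r \<odot>\<^bsub>M\<^esub> z"
        unfolding X_def by auto
      have "r \<odot>\<^bsub>B\<^esub> b = \<ominus>\<^bsub>B\<^esub> x"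
        using * Gc[OF *(1)] b by (metis B.M.minus_equality B.M.a_comm B.smult_closed)
      hence "r \<in> J" using Gneg[OF *(1)] * by (auto simp: J_def)
      hence "(\<zero>\<^bsub>B\<^esub>, v) \<in> G" using Ga[OF *(1) Gz'[of r]] * by simp
      thus "v = \<zero>\<^bsub>M\<^esub>" by (rule Gz)
    qed
    hence "X = G" using max GX by blast
    moreover have "(b, z) \<in> X"
      using G00 b z unfolding X_def
      by (intro CollectI exI[of _ "\<zero>\<^bsub>B\<^esub>"] exI[of _ "\<zero>\<^bsub>M\<^esub>"] exI[of _ "\<one>\<^bsub>R\<^esub>"]) auto
    ultimately show ?thesis by blast
  qed
  define h where "h b = (THE y. (b, y) \<in> G)" for b
  have h_eq: "h b = y" if "(b, y) \<in> G" for b y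
    unfolding h_def using that Gu by blast
  have h: "(b, h b) \<in> G" if "b \<in> carrier B" for b
    using total[OF that] h_eq by metis
  have "h \<in> module_hom R B M"
  proof (rule module_homI)
    fix x assume "x \<in> carrier B"
    then show "h x \<in> carrier M" using Gc[OF h] by simp
  next
    fix x y assume "x \<in> carrier B" "y \<in> carrier B"
    then show "h (x \<oplus>\<^bsub>B\<^esub> y) = h x \<oplus>\<^bsub>M\<^esub> h y" by (intro h_eq Ga h)
  next
    fix r x assume "r \<in> carrier R" "x \<in> carrier B"
    then show "h (r \<odot>\<^bsub>B\<^esub> x) = r \<odot>\<^bsub>M\<^esub> h x" by (intro h_eq Gs h)
  qed
  moreover have "h (f x) = g x" if "x \<in> carrier A" for x
    using G0 that by (intro h_eq) (auto simp: G0_def)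
  ultimately show ?thesis by blast
qed


section \<open>The localization is a commutative ring\<close>

lemma fracI_eq:
  assumes R: "cring R" and S: "submonoid S R"
    and "a \<in> carrier R" "s \<in> S" "b \<in> carrier R" "t \<in> S"
  shows "((a, s), (b, t)) \<in> frac_rel R S \<longleftrightarrow>
    (\<exists>u \<in> S. u \<otimes>\<^bsub>R\<^esub> (t \<otimes>\<^bsub>R\<^esub> a) = u \<otimes>\<^bsub>R\<^esub> (s \<otimes>\<^bsub>R\<^esub> b))"
proof -
  interpret cring R by fact
  have sub: "S \<subseteq> carrier R" using S by (simp add: submonoid.subset)
  have "u \<otimes>\<^bsub>R\<^esub> (t \<otimes>\<^bsub>R\<^esub> a \<ominus>\<^bsub>R\<^esub> s \<otimes>\<^bsub>R\<^esub> b) = \<zero>\<^bsub>R\<^esub> \<longleftrightarrow>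
     u \<otimes>\<^bsub>R\<^esub> (t \<otimes>\<^bsub>R\<^esub> a) = u \<otimes>\<^bsub>R\<^esub> (s \<otimes>\<^bsub>R\<^esub> b)" if "u \<in> S" for u
  proof -
    have c: "u \<in> carrier R" "s \<in> carrier R" "t \<in> carrier R" using that sub assms by auto
    have "u \<otimes>\<^bsub>R\<^esub> (t \<otimes>\<^bsub>R\<^esub> a \<ominus>\<^bsub>R\<^esub> s \<otimes>\<^bsub>R\<^esub> b) = u \<otimes>\<^bsub>R\<^esub> (t \<otimes>\<^bsub>R\<^esub> a) \<ominus>\<^bsub>R\<^esub> u \<otimes>\<^bsub>R\<^esub> (s \<otimes>\<^bsub>R\<^esub> b)"
      using c assms by algebra
    thus ?thesis using c assms by (simp add: r_right_minus_eq)
  qed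
  thus ?thesis using assms unfolding frac_rel_def by auto
qed

lemma frac_rel_equiv:
  assumes R: "cring R" and S: "submonoid S R"
  shows "equiv (carrier R \<times> S) (frac_rel R S)"
proof -
  interpret cring R by fact
  have sub: "S \<subseteq> carrier R" using S by (simp add: submonoid.subset)
  have one: "\<one>\<^bsub>R\<^esub> \<in> S" using S by (simp add: submonoid.one_closed)
  have mc: "\<And>x y. x \<in> S \<Longrightarrow> y \<in> S \<Longrightarrow> x \<otimes>\<^bsub>R\<^esub> y \<in> S" using S by (simp add: submonoid.m_closed)
  note eq = fracI_eq[OF R S]
  show ?thesis
  proof (rule equivI)
    show "frac_rel R S \<subseteq> (carrier R \<times> S) \<times> carrier R \<times> S"
      unfolding frac_rel_def by auto
    show "refl_on (carrier R \<times> S) (frac_rel R S)"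
      using eq one by (auto simp: refl_on_def)
    show "sym (frac_rel R S)"
    proof (rule symI, clarify)
      fix a s b t assume h: "((a, s), (b, t)) \<in> frac_rel R S"
      hence c: "a \<in> carrier R" "s \<in> S" "b \<in> carrier R" "t \<in> S" unfolding frac_rel_def by auto
      show "((b, t), (a, s)) \<in> frac_rel R S" using h eq c by metis
    qed
    show "trans (frac_rel R S)"
    proof (rule transI, clarify)
      fix a s b t d v
      assume h: "((a, s), (b, t)) \<in> frac_rel R S" and k: "((b, t), (d, v)) \<in> frac_rel R S"
      hence c: "a \<in> carrier R" "s \<in> S" "b \<in> carrier R" "t \<in> S" "d \<in> carrier R" "v \<in> S"
        unfolding frac_rel_def by auto
      obtain u where u: "u \<in> S" "u \<otimes>\<^bsub>R\<^esub> (t \<otimes>\<^bsub>R\<^esub> a) = u \<otimes>\<^bsub>R\<^esub> (s \<otimes>\<^bsub>R\<^esub> b)"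
        using h eq c by metis
      obtain w where w: "w \<in> S" "w \<otimes>\<^bsub>R\<^esub> (v \<otimes>\<^bsub>R\<^esub> b) = w \<otimes>\<^bsub>R\<^esub> (t \<otimes>\<^bsub>R\<^esub> d)"
        using k eq c by metis
      have cc: "s \<in> carrier R" "t \<in> carrier R" "v \<in> carrier R" "u \<in> carrier R" "w \<in> carrier R"
        using c u w sub by auto
      have "(u \<otimes>\<^bsub>R\<^esub> w \<otimes>\<^bsub>R\<^esub> t) \<otimes>\<^bsub>R\<^esub> (v \<otimes>\<^bsub>R\<^esub> a) = w \<otimes>\<^bsub>R\<^esub> v \<otimes>\<^bsub>R\<^esub> (u \<otimes>\<^bsub>R\<^esub> (t \<otimes>\<^bsub>R\<^esub> a))"
        using c cc by algebra
      also have "\<dots> = w \<otimes>\<^bsub>R\<^esub> v \<otimes>\<^bsub>R\<^esub> (u \<otimes>\<^bsub>R\<^esub> (s \<otimes>\<^bsub>R\<^esub> b))" using u by simp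
      also have "\<dots> = u \<otimes>\<^bsub>R\<^esub> s \<otimes>\<^bsub>R\<^esub> (w \<otimes>\<^bsub>R\<^esub> (v \<otimes>\<^bsub>R\<^esub> b))" using c cc by algebra
      also have "\<dots> = u \<otimes>\<^bsub>R\<^esub> s \<otimes>\<^bsub>R\<^esub> (w \<otimes>\<^bsub>R\<^esub> (t \<otimes>\<^bsub>R\<^esub> d))" using w by simp
      also have "\<dots> = (u \<otimes>\<^bsub>R\<^esub> w \<otimes>\<^bsub>R\<^esub> t) \<otimes>\<^bsub>R\<^esub> (s \<otimes>\<^bsub>R\<^esub> d)" using c cc by algebra
      finally show "((a, s), (d, v)) \<in> frac_rel R S"
        using eq c u w mc by metis
    qed
  qed
qed

lemma frac_eq_iff:
  assumes "cring R" "submonoid S R" "a \<in> carrier R" "s \<in> S" "b \<in> carrier R" "t \<in> S"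
  shows "frac R S a s = frac R S b t \<longleftrightarrow>
    (\<exists>u \<in> S. u \<otimes>\<^bsub>R\<^esub> (t \<otimes>\<^bsub>R\<^esub> a) = u \<otimes>\<^bsub>R\<^esub> (s \<otimes>\<^bsub>R\<^esub> b))"
  using fracI_eq[OF assms] eq_equiv_class_iff[OF frac_rel_equiv[OF assms(1,2)], of "(a, s)" "(b, t)"] assms
  unfolding frac_def by auto

lemma frac_carrier:
  assumes "a \<in> carrier R" "s \<in> S"
  shows "frac R S a s \<in> carrier (localization R S)"
  using assms unfolding frac_def localization_def by (auto intro: quotientI)

lemma localization_cases:
  assumes "X \<in> carrier (localization R S)"
  obtains a s where "a \<in> carrier R" "s \<in> S" "X = frac R S a s"
  using assms unfolding frac_def localization_def by (auto elim: quotientE)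

lemma frac_mult:
  assumes R: "cring R" and S: "submonoid S R"
    and c: "a \<in> carrier R" "s \<in> S" "b \<in> carrier R" "t \<in> S"
  shows "frac R S a s \<otimes>\<^bsub>localization R S\<^esub> frac R S b t = frac R S (a \<otimes>\<^bsub>R\<^esub> b) (s \<otimes>\<^bsub>R\<^esub> t)"
proof -
  interpret cring R by fact
  have sub: "S \<subseteq> carrier R" using S by (simp add: submonoid.subset)
  have mc: "\<And>x y. x \<in> S \<Longrightarrow> y \<in> S \<Longrightarrow> x \<otimes>\<^bsub>R\<^esub> y \<in> S" using S by (simp add: submonoid.m_closed)
  have key: "frac R S (a' \<otimes>\<^bsub>R\<^esub> b') (s' \<otimes>\<^bsub>R\<^esub> t') = frac R S (a \<otimes>\<^bsub>R\<^esub> b) (s \<otimes>\<^bsub>R\<^esub> t)"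
    if h: "(a', s') \<in> frac R S a s" and k: "(b', t') \<in> frac R S b t" for a' s' b' t'
  proof -
    have c': "a' \<in> carrier R" "s' \<in> S" "b' \<in> carrier R" "t' \<in> S"
      using h k unfolding frac_def frac_rel_def by auto
    obtain u where u: "u \<in> S" "u \<otimes>\<^bsub>R\<^esub> (s' \<otimes>\<^bsub>R\<^esub> a) = u \<otimes>\<^bsub>R\<^esub> (s \<otimes>\<^bsub>R\<^esub> a')"
      using h fracI_eq[OF R S] c c' unfolding frac_def by (metis Image_singleton_iff)
    obtain w where w: "w \<in> S" "w \<otimes>\<^bsub>R\<^esub> (t' \<otimes>\<^bsub>R\<^esub> b) = w \<otimes>\<^bsub>R\<^esub> (t \<otimes>\<^bsub>R\<^esub> b')"
      using k fracI_eq[OF R S] c c' unfolding frac_def by (metis Image_singleton_iff)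
    have cc: "s \<in> carrier R" "t \<in> carrier R" "s' \<in> carrier R" "t' \<in> carrier R" "u \<in> carrier R" "w \<in> carrier R"
      using c c' u w sub by auto
    have "(u \<otimes>\<^bsub>R\<^esub> w) \<otimes>\<^bsub>R\<^esub> ((s \<otimes>\<^bsub>R\<^esub> t) \<otimes>\<^bsub>R\<^esub> (a' \<otimes>\<^bsub>R\<^esub> b')) = (u \<otimes>\<^bsub>R\<^esub> (s \<otimes>\<^bsub>R\<^esub> a')) \<otimes>\<^bsub>R\<^esub> (w \<otimes>\<^bsub>R\<^esub> (t \<otimes>\<^bsub>R\<^esub> b'))"
      using c c' cc by algebra
    also have "\<dots> = (u \<otimes>\<^bsub>R\<^esub> (s' \<otimes>\<^bsub>R\<^esub> a)) \<otimes>\<^bsub>R\<^esub> (w \<otimes>\<^bsub>R\<^esub> (t' \<otimes>\<^bsub>R\<^esub> b))" using u w by simp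
    also have "\<dots> = (u \<otimes>\<^bsub>R\<^esub> w) \<otimes>\<^bsub>R\<^esub> ((s' \<otimes>\<^bsub>R\<^esub> t') \<otimes>\<^bsub>R\<^esub> (a \<otimes>\<^bsub>R\<^esub> b))" using c c' cc by algebra
    finally show ?thesis
      using frac_eq_iff[OF R S] c c' mc u w by (metis m_closed)
  qed
  have ne: "(a, s) \<in> frac R S a s" "(b, t) \<in> frac R S b t"
    using equiv_class_self[OF frac_rel_equiv[OF R S]] c unfolding frac_def by auto
  have "frac R S a s \<otimes>\<^bsub>localization R S\<^esub> frac R S b t =
      (\<Union>(a', s') \<in> frac R S a s. \<Union>(b', t') \<in> frac R S b t. frac R S (a \<otimes>\<^bsub>R\<^esub> b) (s \<otimes>\<^bsub>R\<^esub> t))"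
    unfolding localization_def using key by (auto split: prod.splits) blast+
  thus ?thesis using ne by auto
qed

lemma frac_add:
  assumes R: "cring R" and S: "submonoid S R"
    and c: "a \<in> carrier R" "s \<in> S" "b \<in> carrier R" "t \<in> S"
  shows "frac R S a s \<oplus>\<^bsub>localization R S\<^esub> frac R S b t =
    frac R S (t \<otimes>\<^bsub>R\<^esub> a \<oplus>\<^bsub>R\<^esub> s \<otimes>\<^bsub>R\<^esub> b) (s \<otimes>\<^bsub>R\<^esub> t)"
proof -
  interpret cring R by fact
  have sub: "S \<subseteq> carrier R" using S by (simp add: submonoid.subset)
  have mc: "\<And>x y. x \<in> S \<Longrightarrow> y \<in> S \<Longrightarrow> x \<otimes>\<^bsub>R\<^esub> y \<in> S" using S by (simp add: submonoid.m_closed)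
  have key: "frac R S (t' \<otimes>\<^bsub>R\<^esub> a' \<oplus>\<^bsub>R\<^esub> s' \<otimes>\<^bsub>R\<^esub> b') (s' \<otimes>\<^bsub>R\<^esub> t') =
      frac R S (t \<otimes>\<^bsub>R\<^esub> a \<oplus>\<^bsub>R\<^esub> s \<otimes>\<^bsub>R\<^esub> b) (s \<otimes>\<^bsub>R\<^esub> t)"
    if h: "(a', s') \<in> frac R S a s" and k: "(b', t') \<in> frac R S b t" for a' s' b' t'
  proof -
    have c': "a' \<in> carrier R" "s' \<in> S" "b' \<in> carrier R" "t' \<in> S"
      using h k unfolding frac_def frac_rel_def by auto
    obtain u where u: "u \<in> S" "u \<otimes>\<^bsub>R\<^esub> (s' \<otimes>\<^bsub>R\<^esub> a) = u \<otimes>\<^bsub>R\<^esub> (s \<otimes>\<^bsub>R\<^esub> a')"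
      using h fracI_eq[OF R S] c c' unfolding frac_def by (metis Image_singleton_iff)
    obtain w where w: "w \<in> S" "w \<otimes>\<^bsub>R\<^esub> (t' \<otimes>\<^bsub>R\<^esub> b) = w \<otimes>\<^bsub>R\<^esub> (t \<otimes>\<^bsub>R\<^esub> b')"
      using k fracI_eq[OF R S] c c' unfolding frac_def by (metis Image_singleton_iff)
    have cc: "s \<in> carrier R" "t \<in> carrier R" "s' \<in> carrier R" "t' \<in> carrier R" "u \<in> carrier R" "w \<in> carrier R"
      using c c' u w sub by auto
    have "(u \<otimes>\<^bsub>R\<^esub> w) \<otimes>\<^bsub>R\<^esub> ((s \<otimes>\<^bsub>R\<^esub> t) \<otimes>\<^bsub>R\<^esub> (t' \<otimes>\<^bsub>R\<^esub> a' \<oplus>\<^bsub>R\<^esub> s' \<otimes>\<^bsub>R\<^esub> b')) =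
        w \<otimes>\<^bsub>R\<^esub> t \<otimes>\<^bsub>R\<^esub> t' \<otimes>\<^bsub>R\<^esub> (u \<otimes>\<^bsub>R\<^esub> (s \<otimes>\<^bsub>R\<^esub> a')) \<oplus>\<^bsub>R\<^esub> u \<otimes>\<^bsub>R\<^esub> s \<otimes>\<^bsub>R\<^esub> s' \<otimes>\<^bsub>R\<^esub> (w \<otimes>\<^bsub>R\<^esub> (t \<otimes>\<^bsub>R\<^esub> b'))"
      using c c' cc by algebra
    also have "\<dots> = w \<otimes>\<^bsub>R\<^esub> t \<otimes>\<^bsub>R\<^esub> t' \<otimes>\<^bsub>R\<^esub> (u \<otimes>\<^bsub>R\<^esub> (s' \<otimes>\<^bsub>R\<^esub> a)) \<oplus>\<^bsub>R\<^esub> u \<otimes>\<^bsub>R\<^esub> s \<otimes>\<^bsub>R\<^esub> s' \<otimes>\<^bsub>R\<^esub> (w \<otimes>\<^bsub>R\<^esub> (t' \<otimes>\<^bsub>R\<^esub> b))"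
      using u w by simp
    also have "\<dots> = (u \<otimes>\<^bsub>R\<^esub> w) \<otimes>\<^bsub>R\<^esub> ((s' \<otimes>\<^bsub>R\<^esub> t') \<otimes>\<^bsub>R\<^esub> (t \<otimes>\<^bsub>R\<^esub> a \<oplus>\<^bsub>R\<^esub> s \<otimes>\<^bsub>R\<^esub> b))"
      using c c' cc by algebra
    finally have "\<exists>v\<in>S. v \<otimes>\<^bsub>R\<^esub> ((s \<otimes>\<^bsub>R\<^esub> t) \<otimes>\<^bsub>R\<^esub> (t' \<otimes>\<^bsub>R\<^esub> a' \<oplus>\<^bsub>R\<^esub> s' \<otimes>\<^bsub>R\<^esub> b')) =
      v \<otimes>\<^bsub>R\<^esub> ((s' \<otimes>\<^bsub>R\<^esub> t') \<otimes>\<^bsub>R\<^esub> (t \<otimes>\<^bsub>R\<^esub> a \<oplus>\<^bsub>R\<^esub> s \<otimes>\<^bsub>R\<^esub> b))" using mc u w by blast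
    thus ?thesis
      using frac_eq_iff[OF R S] c c' cc mc by simp
  qed
  have ne: "(a, s) \<in> frac R S a s" "(b, t) \<in> frac R S b t"
    using equiv_class_self[OF frac_rel_equiv[OF R S]] c unfolding frac_def by auto
  have "frac R S a s \<oplus>\<^bsub>localization R S\<^esub> frac R S b t =
      (\<Union>(a', s') \<in> frac R S a s. \<Union>(b', t') \<in> frac R S b t.
         frac R S (t \<otimes>\<^bsub>R\<^esub> a \<oplus>\<^bsub>R\<^esub> s \<otimes>\<^bsub>R\<^esub> b) (s \<otimes>\<^bsub>R\<^esub> t))"
    unfolding localization_def using key by (auto split: prod.splits) blast+
  thus ?thesis using ne by auto
qed

lemma localization_cring:
  assumes R: "cring R" and S: "submonoid S R"
  shows "cring (localization R S)"
proof -
  interpret cring R by fact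
  have sub: "\<And>x. x \<in> S \<Longrightarrow> x \<in> carrier R" using S by (meson submonoid.subset subsetD)
  have one: "\<one>\<^bsub>R\<^esub> \<in> S" using S by (simp add: submonoid.one_closed)
  have mc: "\<And>x y. x \<in> S \<Longrightarrow> y \<in> S \<Longrightarrow> x \<otimes>\<^bsub>R\<^esub> y \<in> S" using S by (simp add: submonoid.m_closed)
  let ?L = "localization R S"
  have one_L: "\<one>\<^bsub>?L\<^esub> = frac R S \<one>\<^bsub>R\<^esub> \<one>\<^bsub>R\<^esub>" and zero_L: "\<zero>\<^bsub>?L\<^esub> = frac R S \<zero>\<^bsub>R\<^esub> \<one>\<^bsub>R\<^esub>"
    unfolding localization_def by auto
  have eqI: "frac R S a s = frac R S b t"
    if "t \<otimes>\<^bsub>R\<^esub> a = s \<otimes>\<^bsub>R\<^esub> b" "a \<in> carrier R" "s \<in> S" "b \<in> carrier R" "t \<in> S" for a s b t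
    using frac_eq_iff[OF R S] that one by metis
  note simps = frac_mult[OF R S] frac_add[OF R S] one_L zero_L
  note C = frac_carrier[of _ R _ S]
  note E = localization_cases[of _ R S]
  show ?thesis
  proof (rule cringI)
    show "abelian_group ?L"
    proof (rule abelian_groupI)
      fix x y assume "x \<in> carrier ?L" "y \<in> carrier ?L"
      then show "x \<oplus>\<^bsub>?L\<^esub> y \<in> carrier ?L"
        by (elim E) (simp add: simps mc sub C)
    next
      show "\<zero>\<^bsub>?L\<^esub> \<in> carrier ?L" by (simp add: simps one C)
    next
      fix x y z assume "x \<in> carrier ?L" "y \<in> carrier ?L" "z \<in> carrier ?L"
      then obtain a s b t d v where c: "a \<in> carrier R" "s \<in> S" "b \<in> carrier R" "t \<in> S" "d \<in> carrier R" "v \<in> S"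
        and e: "x = frac R S a s" "y = frac R S b t" "z = frac R S d v"
        by (metis E)
      have "s \<in> carrier R" "t \<in> carrier R" "v \<in> carrier R" using c sub by auto
      note c' = c this
      have 1: "s \<otimes>\<^bsub>R\<^esub> t \<otimes>\<^bsub>R\<^esub> v = s \<otimes>\<^bsub>R\<^esub> (t \<otimes>\<^bsub>R\<^esub> v)" using c' by algebra
      have 2: "v \<otimes>\<^bsub>R\<^esub> (t \<otimes>\<^bsub>R\<^esub> a \<oplus>\<^bsub>R\<^esub> s \<otimes>\<^bsub>R\<^esub> b) \<oplus>\<^bsub>R\<^esub> s \<otimes>\<^bsub>R\<^esub> t \<otimes>\<^bsub>R\<^esub> d =
         t \<otimes>\<^bsub>R\<^esub> v \<otimes>\<^bsub>R\<^esub> a \<oplus>\<^bsub>R\<^esub> s \<otimes>\<^bsub>R\<^esub> (v \<otimes>\<^bsub>R\<^esub> b \<oplus>\<^bsub>R\<^esub> t \<otimes>\<^bsub>R\<^esub> d)" using c' by algebra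
      show "x \<oplus>\<^bsub>?L\<^esub> y \<oplus>\<^bsub>?L\<^esub> z = x \<oplus>\<^bsub>?L\<^esub> (y \<oplus>\<^bsub>?L\<^esub> z)"
        using c' mc by (simp only: e simps m_closed a_closed mc 1 2)
    next
      fix x y assume "x \<in> carrier ?L" "y \<in> carrier ?L"
      then show "x \<oplus>\<^bsub>?L\<^esub> y = y \<oplus>\<^bsub>?L\<^esub> x"
        by (elim E) (simp add: simps mc sub C m_comm a_comm)
    next
      fix x assume "x \<in> carrier ?L"
      then show "\<zero>\<^bsub>?L\<^esub> \<oplus>\<^bsub>?L\<^esub> x = x"
        by (elim E) (simp add: simps mc sub C one)
      from \<open>x \<in> carrier ?L\<close> show "\<exists>y\<in>carrier ?L. y \<oplus>\<^bsub>?L\<^esub> x = \<zero>\<^bsub>?L\<^esub>"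
      proof (elim E)
        fix a s assume c: "a \<in> carrier R" "s \<in> S" "x = frac R S a s"
        have "s \<in> carrier R" using c sub by auto
        note c' = c this
        have z: "s \<otimes>\<^bsub>R\<^esub> (\<ominus>\<^bsub>R\<^esub> a) \<oplus>\<^bsub>R\<^esub> s \<otimes>\<^bsub>R\<^esub> a = \<zero>\<^bsub>R\<^esub>" using c' by algebra
        have "frac R S (\<ominus>\<^bsub>R\<^esub> a) s \<oplus>\<^bsub>?L\<^esub> x = frac R S \<zero>\<^bsub>R\<^esub> (s \<otimes>\<^bsub>R\<^esub> s)"
          using c' z by (simp add: simps)
        also have "\<dots> = \<zero>\<^bsub>?L\<^esub>" unfolding zero_L by (rule eqI) (use c' mc one in auto)
        finally show ?thesis using C[of "\<ominus>\<^bsub>R\<^esub> a" s] c' by blast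
      qed
    qed
    show "comm_monoid ?L"
    proof (rule comm_monoidI)
      fix x y assume "x \<in> carrier ?L" "y \<in> carrier ?L"
      then show "x \<otimes>\<^bsub>?L\<^esub> y \<in> carrier ?L" "x \<otimes>\<^bsub>?L\<^esub> y = y \<otimes>\<^bsub>?L\<^esub> x"
        by (elim E, simp add: simps mc sub C m_comm)+
    next
      show "\<one>\<^bsub>?L\<^esub> \<in> carrier ?L" by (simp add: simps one C)
    next
      fix x y z assume "x \<in> carrier ?L" "y \<in> carrier ?L" "z \<in> carrier ?L"
      then show "x \<otimes>\<^bsub>?L\<^esub> y \<otimes>\<^bsub>?L\<^esub> z = x \<otimes>\<^bsub>?L\<^esub> (y \<otimes>\<^bsub>?L\<^esub> z)"
        by (elim E) (simp add: simps mc sub C m_assoc)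
    next
      fix x assume "x \<in> carrier ?L"
      then show "\<one>\<^bsub>?L\<^esub> \<otimes>\<^bsub>?L\<^esub> x = x"
        by (elim E) (simp add: simps mc sub C one)
    qed
    fix x y z assume "x \<in> carrier ?L" "y \<in> carrier ?L" "z \<in> carrier ?L"
    then obtain a s b t d v where c: "a \<in> carrier R" "s \<in> S" "b \<in> carrier R" "t \<in> S" "d \<in> carrier R" "v \<in> S"
      and e: "x = frac R S a s" "y = frac R S b t" "z = frac R S d v"
      by (metis E)
    have "s \<in> carrier R" "t \<in> carrier R" "v \<in> carrier R" using c sub by auto
    note c' = c this
    have 1: "(s \<otimes>\<^bsub>R\<^esub> v \<otimes>\<^bsub>R\<^esub> (t \<otimes>\<^bsub>R\<^esub> v)) \<otimes>\<^bsub>R\<^esub> ((t \<otimes>\<^bsub>R\<^esub> a \<oplus>\<^bsub>R\<^esub> s \<otimes>\<^bsub>R\<^esub> b) \<otimes>\<^bsub>R\<^esub> d) =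
      (s \<otimes>\<^bsub>R\<^esub> t \<otimes>\<^bsub>R\<^esub> v) \<otimes>\<^bsub>R\<^esub> (t \<otimes>\<^bsub>R\<^esub> v \<otimes>\<^bsub>R\<^esub> (a \<otimes>\<^bsub>R\<^esub> d) \<oplus>\<^bsub>R\<^esub> s \<otimes>\<^bsub>R\<^esub> v \<otimes>\<^bsub>R\<^esub> (b \<otimes>\<^bsub>R\<^esub> d))"
      using c' by algebra
    show "(x \<oplus>\<^bsub>?L\<^esub> y) \<otimes>\<^bsub>?L\<^esub> z = x \<otimes>\<^bsub>?L\<^esub> z \<oplus>\<^bsub>?L\<^esub> y \<otimes>\<^bsub>?L\<^esub> z"
      using c' mc eqI[OF 1] by (simp only: e simps m_closed a_closed mc)
  qed
qed

lemma localize_at_cring: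
  assumes p: "primeideal p R"
  shows "cring (localize_at R p)"
proof -
  interpret primeideal p R by fact
  have "submonoid (carrier R - p) R"
    by (rule submonoid.intro) (use I_prime one_imp_carrier I_notcarr in auto)
  thus ?thesis unfolding localize_at_def by (rule localization_cring[OF is_cring])
qed

end

theory Submission
  imports Defs
begin

text \<open>Let \<open>J\<close> be the annihilator of \<open>I\<close> in \<open>R\<close>. Both sides of the equivalence say that
\<open>J\<close> kills \<open>M\<close>.

A sum of copies of \<open>I\<close> is killed by \<open>J\<close>, hence so is every \<open>I\<close>-generated module.
Conversely, if \<open>I\<close> is generated by \<open>a\<^sub>1, \<dots>, a\<^sub>n\<close>, then \<open>R/J\<close> embeds into
\<open>R\<^sup>n\<close> by \<open>r \<mapsto> (r a\<^sub>1, \<dots>, r a\<^sub>n)\<close>. If \<open>J x = 0\<close>, injectivity extends the map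
\<open>r \<mapsto> r x\<close> from \<open>R/J\<close> to \<open>R\<^sup>n\<close>, which writes \<open>x\<close> as a sum of elements
\<open>a\<^sub>i z\<^sub>i\<close>. So \<open>I M\<close> is the set of all \<open>x\<close> with \<open>J x = 0\<close>; the proof below
(\<open>annihilated_mem_submodule\<close>) adds the generators one at a time and only extends maps from
ideals to \<open>R\<close>.

For \<open>c \<in> R\<close>, killing \<open>M\<close> is a condition at the associated primes
(\<open>annihilated_iff_locally_zero\<close>): if \<open>c x \<noteq> 0\<close>, some multiple of \<open>c x\<close> has a prime
annihilator \<open>p\<close>, and \<open>c/1 \<noteq> 0\<close> in \<open>R\<^sub>p\<close>. Conversely, if \<open>p = Ann x\<close> and
\<open>c/1 \<noteq> 0\<close> in \<open>R\<^sub>p\<close>, then \<open>Ann c \<subseteq> p\<close>, so \<open>r c \<mapsto> r x\<close> is a well-defined map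
\<open>R c \<rightarrow> M\<close>; extending it to \<open>R\<close> gives \<open>x = c z \<in> c M\<close>, so \<open>c M \<noteq> 0\<close>.

It remains to see that \<open>J\<^sub>p = 0\<close> means that \<open>I\<^sub>p\<close> contains a non-zero-divisor
(\<open>regular_localization_iff\<close>). This is the classical fact that in a noetherian ring an ideal
with zero annihilator is regular. It is proved in \<open>R\<close> relative to an ideal \<open>N\<close>
(\<open>exists_nonzerodivisor_mod\<close>) and applied to the kernel \<open>N\<close> of \<open>R \<rightarrow> R\<^sub>p\<close>.\<close>

section \<open>Ideals of a noetherian ring\<close>

text \<open>The ideal quotient \<open>(N : y)\<close>, which is the annihilator of the class of \<open>y\<close> in
\<open>R/N\<close>.\<close>

definition colon :: "('a, 'r) ring_scheme \<Rightarrow> 'a set \<Rightarrow> 'a \<Rightarrow> 'a set"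
  where "colon R N y = {r \<in> carrier R. r \<otimes>\<^bsub>R\<^esub> y \<in> N}"

lemma (in cring) ideal_by_closure:
  assumes "K \<subseteq> carrier R" "\<zero> \<in> K"
    and add: "\<And>x y. x \<in> K \<Longrightarrow> y \<in> K \<Longrightarrow> x \<oplus> y \<in> K"
    and mult: "\<And>r x. r \<in> carrier R \<Longrightarrow> x \<in> K \<Longrightarrow> r \<otimes> x \<in> K"
  shows "ideal K R"
proof (rule idealI)
  show "ring R" by (rule ring_axioms)
  show "subgroup K (add_monoid R)"
  proof (rule add.subgroupI)
    fix x assume x: "x \<in> K"
    have "\<ominus> x = (\<ominus> \<one>) \<otimes> x" using x assms(1) by (auto simp: l_minus)
    then show "\<ominus> x \<in> K" using mult[of "\<ominus> \<one>" x] x by simp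
  qed (use assms in auto)
  fix x r assume *: "x \<in> K" "r \<in> carrier R"
  then show "r \<otimes> x \<in> K" by (rule mult[rotated])
  then show "x \<otimes> r \<in> K" using * assms(1) by (metis m_comm subsetD)
qed

lemma (in cring) colon_ideal:
  assumes "ideal N R" "y \<in> carrier R"
  shows "ideal (colon R N y) R"
proof -
  interpret N: ideal N R by fact
  show ?thesis
    by (rule ideal_by_closure)
      (use assms(2) in \<open>auto simp: colon_def l_distr m_assoc N.I_l_closed\<close>)
qed

lemma (in cring)
  assumes K: "ideal K R" and z: "z \<in> carrier R"
  shows adjoin_ideal: "ideal {k \<oplus> r \<otimes> z | k r. k \<in> K \<and> r \<in> carrier R} R"
    and adjoin_subset: "K \<subseteq> {k \<oplus> r \<otimes> z | k r. k \<in> K \<and> r \<in> carrier R}"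
    and adjoin_mem: "z \<in> {k \<oplus> r \<otimes> z | k r. k \<in> K \<and> r \<in> carrier R}"
proof -
  interpret K: ideal K R by fact
  let ?K' = "{k \<oplus> r \<otimes> z | k r. k \<in> K \<and> r \<in> carrier R}"
  show KK': "K \<subseteq> ?K'"
  proof
    fix k assume "k \<in> K"
    then have "k = k \<oplus> \<zero> \<otimes> z" using z K.Icarr by simp
    then show "k \<in> ?K'" using \<open>k \<in> K\<close> by blast
  qed
  show "z \<in> ?K'"
    using z by (intro CollectI exI[of _ \<zero>] exI[of _ \<one>]) auto
  show "ideal ?K' R"
  proof (rule ideal_by_closure)
    show "?K' \<subseteq> carrier R" using z K.Icarr by auto
    show "\<zero> \<in> ?K'" using KK' K.zero_closed by blast
  next
    fix x y assume "x \<in> ?K'" "y \<in> ?K'"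
    then obtain k r l s where *: "k \<in> K" "r \<in> carrier R" "x = k \<oplus> r \<otimes> z"
      "l \<in> K" "s \<in> carrier R" "y = l \<oplus> s \<otimes> z" by auto
    have "x \<oplus> y = (k \<oplus> l) \<oplus> (r \<oplus> s) \<otimes> z"
      using * K.Icarr[of k] K.Icarr[of l] z by (simp add: l_distr a_ac)
    then show "x \<oplus> y \<in> ?K'" using * by blast
  next
    fix s x assume s: "s \<in> carrier R" and "x \<in> ?K'"
    then obtain k r where *: "k \<in> K" "r \<in> carrier R" "x = k \<oplus> r \<otimes> z"
      by auto
    have "s \<otimes> x = s \<otimes> k \<oplus> (s \<otimes> r) \<otimes> z"
      using * K.Icarr[of k] z s by (simp add: r_distr m_assoc)
    then show "s \<otimes> x \<in> ?K'" using * s K.I_l_closed by blast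
  qed
qed

lemma (in ring) ideal_diff_mem:
  assumes "ideal K R" "a \<in> carrier R" "a \<oplus> b \<in> K" "b \<in> K"
  shows "a \<in> K"
proof -
  interpret K: ideal K R by fact
  have "a = (a \<oplus> b) \<oplus> \<ominus> b"
    using assms K.Icarr by (metis a_assoc a_inv_closed r_neg r_zero)
  then show ?thesis using assms K.a_closed K.a_inv_closed by metis
qed

lemma (in noetherian_ring) exists_maximal_ideal_in:
  assumes "K \<in> F" "\<And>K. K \<in> F \<Longrightarrow> ideal K R"
  shows "\<exists>P\<in>F. K \<subseteq> P \<and> (\<forall>Q\<in>F. P \<subseteq> Q \<longrightarrow> Q = P)"
proof -
  have "\<exists>P\<in>{Q \<in> F. K \<subseteq> Q}. \<forall>X\<in>{Q \<in> F. K \<subseteq> Q}. P \<subseteq> X \<longrightarrow> X = P"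
  proof (rule subset_Zorn_nonempty)
    show "{Q \<in> F. K \<subseteq> Q} \<noteq> {}" using assms(1) by blast
    fix C assume C: "C \<noteq> {}" "subset.chain {Q \<in> F. K \<subseteq> Q} C"
    then have "subset.chain {I. ideal I R} C"
      using assms(2) by (auto simp: subset_chain_def)
    then show "\<Union>C \<in> {Q \<in> F. K \<subseteq> Q}"
      using ideal_chain_is_trivial[OF C(1)] C(2) by (auto simp: subset_chain_def)
  qed
  then obtain P where "P \<in> F" "K \<subseteq> P"
    and max: "\<And>X. X \<in> F \<Longrightarrow> K \<subseteq> X \<Longrightarrow> P \<subseteq> X \<Longrightarrow> X = P"
    by (auto simp only: mem_Collect_eq bex_simps ball_simps)
  moreover have "Q = P" if "Q \<in> F" "P \<subseteq> Q" for Q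
    using max[OF that(1) _ that(2)] \<open>K \<subseteq> P\<close> that(2) by simp
  ultimately show ?thesis by auto
qed

locale noetherian_cring = noetherian_ring + cring
begin

lemma maximal_colon_above:
  assumes N: "ideal N R" and y: "y \<in> carrier R - N"
  shows "\<exists>z\<in>carrier R - N. colon R N y \<subseteq> colon R N z \<and>
    (\<forall>w\<in>carrier R - N. colon R N z \<subseteq> colon R N w \<longrightarrow> colon R N w = colon R N z)"
proof -
  have "\<And>K. K \<in> colon R N ` (carrier R - N) \<Longrightarrow> ideal K R"
    using colon_ideal[OF N] by auto
  then have "\<exists>P\<in>colon R N ` (carrier R - N). colon R N y \<subseteq> P \<and>
      (\<forall>Q\<in>colon R N ` (carrier R - N). P \<subseteq> Q \<longrightarrow> Q = P)"
    by (rule exists_maximal_ideal_in[OF imageI[OF y]])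
  then show ?thesis by (simp only: bex_simps ball_simps)
qed

text \<open>If \<open>a z \<notin> N\<close>, then \<open>(N : z) \<subseteq> (N : a z)\<close>, and maximality forces equality; so
\<open>a b \<in> (N : z)\<close> gives \<open>b \<in> (N : a z) = (N : z)\<close>.\<close>

lemma maximal_colon_prime:
  assumes N: "ideal N R" and z: "z \<in> carrier R - N"
    and max: "\<And>w. w \<in> carrier R - N \<Longrightarrow> colon R N z \<subseteq> colon R N w \<Longrightarrow> colon R N w = colon R N z"
  shows "primeideal (colon R N z) R"
proof (rule primeidealI[OF colon_ideal[OF N] is_cring])
  interpret N: ideal N R by fact
  have "\<one> \<notin> colon R N z" using z by (simp add: colon_def)
  then show "carrier R \<noteq> colon R N z" using one_closed by metis
  fix a b assume ab: "a \<in> carrier R" "b \<in> carrier R" "a \<otimes> b \<in> colon R N z"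
  show "a \<in> colon R N z \<or> b \<in> colon R N z"
  proof (cases "a \<otimes> z \<in> N")
    case True
    then show ?thesis using ab by (simp add: colon_def)
  next
    case False
    have "r \<otimes> (a \<otimes> z) \<in> N" if "r \<in> carrier R" "r \<otimes> z \<in> N" for r
      using N.I_l_closed[OF that(2) ab(1)] that(1) ab z by (simp add: m_lcomm)
    then have "colon R N (a \<otimes> z) = colon R N z"
      using False ab z by (intro max) (auto simp: colon_def)
    moreover have "b \<in> colon R N (a \<otimes> z)"
      using ab z by (auto simp: colon_def m_ac)
    ultimately show ?thesis by simp
  qed
qed (use z in auto)

text \<open>The proof enlarges an ideal \<open>K\<close> on which some \<open>a \<in> I\<close> acts injectively
modulo \<open>N\<close>. If \<open>a\<close> lies in a maximal annihilator \<open>P = (N : z)\<close>, it is replaced by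
\<open>a + t b\<close>, where \<open>b \<in> I - P\<close> and \<open>t \<notin> P\<close> kills \<open>K\<close> modulo \<open>N\<close>. The new element acts
like \<open>a\<close> on \<open>K\<close> and like \<open>t b\<close> on \<open>R z + N / N\<close>, which is a copy of \<open>R/P\<close>, so it acts
injectively on \<open>K + R z\<close>. By noetherianness this stops, and then \<open>a\<close> lies in no maximal
annihilator, hence in no annihilator of a nonzero element of \<open>R/N\<close>.\<close>

lemma exists_nonzerodivisor_mod:
  assumes N: "ideal N R" and I: "ideal I R"
    and NI: "\<And>y. y \<in> carrier R \<Longrightarrow> (\<And>b. b \<in> I \<Longrightarrow> b \<otimes> y \<in> N) \<Longrightarrow> y \<in> N"
  shows "\<exists>a\<in>I. \<forall>y\<in>carrier R. a \<otimes> y \<in> N \<longrightarrow> y \<in> N"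
proof -
  interpret N: ideal N R by fact
  interpret I: ideal I R by fact
  define maxcol where "maxcol z \<longleftrightarrow> z \<in> carrier R - N \<and>
    (\<forall>w \<in> carrier R - N. colon R N z \<subseteq> colon R N w \<longrightarrow> colon R N w = colon R N z)" for z
  have prime: "primeideal (colon R N z) R" if "maxcol z" for z
    by (rule maximal_colon_prime[OF N]) (use that in \<open>auto simp: maxcol_def\<close>)
  \<comment> \<open>The second condition, that \<open>(N : K)\<close> is not contained in any maximal annihilator that
    contains \<open>a\<close>, provides the factor \<open>t\<close> of the next step.\<close>
  define good where "good K a \<longleftrightarrow> a \<in> I \<and> (\<forall>y\<in>K. a \<otimes> y \<in> N \<longrightarrow> y \<in> N) \<and>
    (\<forall>z. maxcol z \<and> a \<in> colon R N z \<longrightarrow>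
      (\<exists>t\<in>carrier R. (\<forall>k\<in>K. t \<otimes> k \<in> N) \<and> t \<notin> colon R N z))" for K a
  define F where "F = {K. ideal K R \<and> (\<exists>a. good K a)}"
  \<comment> \<open>On \<open>N\<close> itself every element acts injectively modulo \<open>N\<close>, even zero.\<close>
  have "good N \<zero>"
    unfolding good_def maxcol_def colon_def
    by (auto simp: N.I_l_closed intro!: bexI[of _ \<one>])
  then have "N \<in> F" using N by (auto simp: F_def)
  moreover have Fi: "\<And>K. K \<in> F \<Longrightarrow> ideal K R" by (simp add: F_def)
  ultimately obtain K where K: "K \<in> F" and Kmax: "\<And>Q. Q \<in> F \<Longrightarrow> K \<subseteq> Q \<Longrightarrow> Q = K"
    using exists_maximal_ideal_in[of N F] by metis
  from K obtain a where Ki: "ideal K R" and g: "good K a" unfolding F_def by blast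
  interpret K: ideal K R by fact
  have aI: "a \<in> I" and aK: "\<And>y. y \<in> K \<Longrightarrow> a \<otimes> y \<in> N \<Longrightarrow> y \<in> N"
    and aP: "\<And>z. maxcol z \<Longrightarrow> a \<in> colon R N z \<Longrightarrow>
      \<exists>t\<in>carrier R. (\<forall>k\<in>K. t \<otimes> k \<in> N) \<and> t \<notin> colon R N z"
    using g unfolding good_def by simp_all
  have ac: "a \<in> carrier R" using aI by (rule I.Icarr)
  have none: "a \<notin> colon R N z" if z: "maxcol z" for z
  proof
    assume az: "a \<in> colon R N z"
    note P = primeideal.I_prime[OF prime[OF z]] and Pi = primeideal.axioms(1)[OF prime[OF z]]
    have zc: "z \<in> carrier R" "z \<notin> N" using z by (auto simp: maxcol_def)
    obtain t where t: "t \<in> carrier R" "\<And>k. k \<in> K \<Longrightarrow> t \<otimes> k \<in> N" "t \<notin> colon R N z"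
      using aP[OF z az] by auto
    obtain b where b: "b \<in> I" "b \<otimes> z \<notin> N" using NI[OF zc(1)] zc(2) by auto
    have bc: "b \<in> carrier R" using b(1) by (rule I.Icarr)
    have bP: "b \<notin> colon R N z" using b(2) unfolding colon_def by blast
    have tb: "t \<otimes> b \<notin> colon R N z" using P[OF t(1) bc] t(3) bP by metis
    define a' where "a' = a \<oplus> t \<otimes> b"
    define K' where "K' = {k \<oplus> r \<otimes> z | k r. k \<in> K \<and> r \<in> carrier R}"
    have a'I: "a' \<in> I" using aI b t(1) by (auto simp: a'_def I.I_l_closed)
    have K'i: "ideal K' R" and KK': "K \<subseteq> K'" and zK': "z \<in> K'"
      unfolding K'_def by (rule adjoin_ideal adjoin_subset adjoin_mem; use Ki zc(1) in simp)+
    have azN: "a \<otimes> z \<in> N" using az by (simp add: colon_def)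
    have "good K' a'"
      unfolding good_def
    proof (intro conjI ballI allI impI)
      show "a' \<in> I" by (rule a'I)
    next
      fix x assume "x \<in> K'" and xN: "a' \<otimes> x \<in> N"
      then obtain k r where x: "k \<in> K" "r \<in> carrier R" "x = k \<oplus> r \<otimes> z"
        by (auto simp: K'_def)
      have kc: "k \<in> carrier R" using x(1) by (rule K.Icarr)
      have tk: "t \<otimes> k \<in> N" using t(2) x(1) .
      have btk: "b \<otimes> (t \<otimes> k) \<in> N" and raz: "r \<otimes> (a \<otimes> z) \<in> N"
        using tk azN bc x(2) by (auto intro: N.I_l_closed)
      have e: "a' \<otimes> x = (a \<otimes> k \<oplus> r \<otimes> (t \<otimes> b) \<otimes> z) \<oplus> (b \<otimes> (t \<otimes> k) \<oplus> r \<otimes> (a \<otimes> z))"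
        unfolding a'_def x(3) using ac bc kc t(1) x(2) zc(1) by algebra
      have 1: "a \<otimes> k \<oplus> r \<otimes> (t \<otimes> b) \<otimes> z \<in> N"
        by (rule ideal_diff_mem[OF N, of _ "b \<otimes> (t \<otimes> k) \<oplus> r \<otimes> (a \<otimes> z)"])
          (use xN e btk raz ac bc kc t(1) x(2) zc(1) in auto)
      \<comment> \<open>Multiplying by \<open>t\<close> removes the \<open>k\<close>-part and isolates \<open>z\<close>.\<close>
      have e2: "t \<otimes> (a \<otimes> k \<oplus> r \<otimes> (t \<otimes> b) \<otimes> z) = t \<otimes> (t \<otimes> b) \<otimes> r \<otimes> z \<oplus> a \<otimes> (t \<otimes> k)"
        using ac bc kc t(1) x(2) zc(1) by algebra
      have "t \<otimes> (t \<otimes> b) \<otimes> r \<otimes> z \<in> N"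
        by (rule ideal_diff_mem[OF N, of _ "a \<otimes> (t \<otimes> k)"])
          (use N.I_l_closed[OF 1 t(1)] N.I_l_closed[OF tk ac] e2 ac bc kc t(1) x(2) zc(1) in auto)
      then have "t \<otimes> (t \<otimes> b) \<otimes> r \<in> colon R N z"
        using bc t(1) x(2) by (simp add: colon_def)
      then have "r \<in> colon R N z"
        using P tb t(1,3) bc x(2) by (metis m_closed)
      then have rz: "r \<otimes> z \<in> N" by (simp add: colon_def)
      have "(t \<otimes> b) \<otimes> (r \<otimes> z) \<in> N" using rz t(1) bc by (auto intro: N.I_l_closed)
      then have "r \<otimes> (t \<otimes> b) \<otimes> z \<in> N" using t(1) bc x(2) zc(1) by (simp add: m_ac)
      with 1 have "a \<otimes> k \<in> N"
        using ideal_diff_mem[OF N _ 1] ac kc by auto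
      then have "k \<in> N" using aK x(1) by blast
      then show "x \<in> N" using rz x(3) by simp
    next
      fix w assume w: "maxcol w \<and> a' \<in> colon R N w"
      have wp: "primeideal (colon R N w) R" using w by (blast intro: prime)
      note Q = primeideal.I_prime[OF wp] and Qi = primeideal.axioms(1)[OF wp]
      have wc: "w \<in> carrier R" "w \<notin> N" using w by (auto simp: maxcol_def)
      have "\<exists>t''\<in>carrier R. (\<forall>k\<in>K. t'' \<otimes> k \<in> N) \<and> t'' \<notin> colon R N w"
      proof (cases "t \<in> colon R N w")
        case True
        then have "t \<otimes> b \<in> colon R N w" using bc by (rule ideal.I_r_closed[OF Qi])
        then have "a \<in> colon R N w"
          using ideal_diff_mem[OF Qi ac] w unfolding a'_def by blast
        then show ?thesis using aP[of w] w by blast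
      qed (use t in blast)
      then obtain t'' where t'': "t'' \<in> carrier R" "\<And>k. k \<in> K \<Longrightarrow> t'' \<otimes> k \<in> N"
        "t'' \<notin> colon R N w" by blast
      \<comment> \<open>An element of \<open>(N : K) \<inter> (N : z)\<close> outside the prime \<open>(N : w)\<close> is found as a
        product, so each factor of the intersection has to be outside \<open>(N : w)\<close> separately.\<close>
      have "\<not> colon R N z \<subseteq> colon R N w"
      proof
        assume "colon R N z \<subseteq> colon R N w"
        then have eq: "colon R N w = colon R N z" using z wc by (auto simp: maxcol_def)
        have "t \<otimes> b \<in> colon R N z"
          by (rule ideal_diff_mem[OF Pi, of _ a])
            (use w eq az ac bc t(1) in \<open>auto simp: a'_def a_comm\<close>)
        with tb show False ..
      qed
      then obtain s where s: "s \<in> colon R N z" "s \<notin> colon R N w" by blast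
      have sc: "s \<in> carrier R" and szN: "s \<otimes> z \<in> N" using s(1) by (auto simp: colon_def)
      show "\<exists>t\<in>carrier R. (\<forall>k\<in>K'. t \<otimes> k \<in> N) \<and> t \<notin> colon R N w"
      proof (intro bexI[of _ "t'' \<otimes> s"] conjI ballI)
        show "t'' \<otimes> s \<notin> colon R N w" using Q[OF t''(1) sc] t''(3) s(2) by blast
        fix x assume "x \<in> K'"
        then obtain k r where x: "k \<in> K" "r \<in> carrier R" "x = k \<oplus> r \<otimes> z"
          by (auto simp: K'_def)
        have kc: "k \<in> carrier R" using x(1) by (rule K.Icarr)
        have "t'' \<otimes> s \<otimes> x = s \<otimes> (t'' \<otimes> k) \<oplus> (t'' \<otimes> r) \<otimes> (s \<otimes> z)"
          unfolding x(3) using kc t''(1) x(2) sc zc(1) by algebra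
        then show "t'' \<otimes> s \<otimes> x \<in> N"
          using N.a_closed[OF N.I_l_closed[OF t''(2)[OF x(1)] sc] N.I_l_closed[OF szN, of "t'' \<otimes> r"]]
            t''(1) x(2) by simp
      qed (use t'' sc in auto)
    qed
    then have "K' = K" using Kmax KK' K'i by (auto simp: F_def)
    then show False using zK' aK azN zc(2) by blast
  qed
  have "y \<in> N" if y: "y \<in> carrier R" "a \<otimes> y \<in> N" for y
  proof (rule ccontr)
    assume "y \<notin> N"
    then obtain z where "z \<in> carrier R - N" "colon R N y \<subseteq> colon R N z"
      "\<And>w. w \<in> carrier R - N \<Longrightarrow> colon R N z \<subseteq> colon R N w \<Longrightarrow> colon R N w = colon R N z"
      using maximal_colon_above[OF N, of y] y by auto
    then have "maxcol z" "a \<in> colon R N z"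
      using y ac by (auto simp: maxcol_def colon_def)
    then show False using none by blast
  qed
  then show ?thesis using aI by blast
qed

end


section \<open>Generation by an ideal and its annihilator\<close>

definition ideal_annihilator :: "('a, 'r) ring_scheme \<Rightarrow> 'a set \<Rightarrow> 'a set"
  where "ideal_annihilator R I = {c \<in> carrier R. \<forall>b\<in>I. c \<otimes>\<^bsub>R\<^esub> b = \<zero>\<^bsub>R\<^esub>}"

lemma (in cring) ideal_annihilator_ideal:
  assumes "ideal I R"
  shows "ideal (ideal_annihilator R I) R"
proof -
  interpret I: ideal I R by fact
  show ?thesis
    by (rule ideal_by_closure) (auto simp: ideal_annihilator_def I.Icarr l_distr m_assoc)
qed

text \<open>The map \<open>r a \<mapsto> r x\<close> on the ideal \<open>J a\<close> is well defined by the last assumption, and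
injectivity turns it into multiplication by some \<open>z\<close>. For \<open>J = R\<close> this gives \<open>x = a z\<close>.\<close>

lemma injective_module_factor:
  assumes inj: "injective_module R M" and J: "ideal J R"
    and a: "a \<in> carrier R" and x: "x \<in> carrier M"
    and ann: "\<And>r. r \<in> J \<Longrightarrow> r \<otimes>\<^bsub>R\<^esub> a = \<zero>\<^bsub>R\<^esub> \<Longrightarrow> r \<odot>\<^bsub>M\<^esub> x = \<zero>\<^bsub>M\<^esub>"
  shows "\<exists>z\<in>carrier M. \<forall>r\<in>J. r \<odot>\<^bsub>M\<^esub> (a \<odot>\<^bsub>M\<^esub> z) = r \<odot>\<^bsub>M\<^esub> x"
proof -
  interpret M: module R M using inj by (simp add: injective_module_def)
  interpret J: ideal J R by fact
  define Ja where "Ja = {r \<otimes>\<^bsub>R\<^esub> a | r. r \<in> J}"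
  have Ja: "ideal Ja R"
  proof (rule M.R.ideal_by_closure)
    show "Ja \<subseteq> carrier R" using a J.Icarr by (auto simp: Ja_def)
    have "\<zero>\<^bsub>R\<^esub> = \<zero>\<^bsub>R\<^esub> \<otimes>\<^bsub>R\<^esub> a" using a by simp
    then show "\<zero>\<^bsub>R\<^esub> \<in> Ja" using J.zero_closed unfolding Ja_def by blast
  next
    fix u v assume "u \<in> Ja" "v \<in> Ja"
    then obtain r s where rs: "r \<in> J" "s \<in> J" "u = r \<otimes>\<^bsub>R\<^esub> a" "v = s \<otimes>\<^bsub>R\<^esub> a"
      unfolding Ja_def by blast
    then have "u \<oplus>\<^bsub>R\<^esub> v = (r \<oplus>\<^bsub>R\<^esub> s) \<otimes>\<^bsub>R\<^esub> a" using a J.Icarr by (simp add: M.R.l_distr)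
    then show "u \<oplus>\<^bsub>R\<^esub> v \<in> Ja" using rs J.a_closed unfolding Ja_def by blast
  next
    fix s u assume s: "s \<in> carrier R" and "u \<in> Ja"
    then obtain r where r: "r \<in> J" "u = r \<otimes>\<^bsub>R\<^esub> a"
      unfolding Ja_def by blast
    then have "s \<otimes>\<^bsub>R\<^esub> u = (s \<otimes>\<^bsub>R\<^esub> r) \<otimes>\<^bsub>R\<^esub> a" using s a J.Icarr by (simp add: M.R.m_assoc)
    then show "s \<otimes>\<^bsub>R\<^esub> u \<in> Ja" using r s J.I_l_closed unfolding Ja_def by blast
  qed
  define \<phi> where "\<phi> s = (SOME r. r \<in> J \<and> s = r \<otimes>\<^bsub>R\<^esub> a) \<odot>\<^bsub>M\<^esub> x" for s
  have \<phi>: "\<phi> (r \<otimes>\<^bsub>R\<^esub> a) = r \<odot>\<^bsub>M\<^esub> x" if r: "r \<in> J" for r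
  proof -
    define q where "q = (SOME q. q \<in> J \<and> r \<otimes>\<^bsub>R\<^esub> a = q \<otimes>\<^bsub>R\<^esub> a)"
    have q: "q \<in> J \<and> r \<otimes>\<^bsub>R\<^esub> a = q \<otimes>\<^bsub>R\<^esub> a"
      unfolding q_def by (rule someI_ex) (use r in blast)
    have c: "q \<in> carrier R" "r \<in> carrier R" using q r J.Icarr by auto
    have d: "q \<oplus>\<^bsub>R\<^esub> \<ominus>\<^bsub>R\<^esub> r \<in> J" using q r by (auto intro: J.a_closed J.a_inv_closed)
    have "(q \<oplus>\<^bsub>R\<^esub> \<ominus>\<^bsub>R\<^esub> r) \<otimes>\<^bsub>R\<^esub> a = \<zero>\<^bsub>R\<^esub>"
      using q a c by (simp add: M.R.l_distr M.R.l_minus M.R.r_neg)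
    from ann[OF d this] have "q \<odot>\<^bsub>M\<^esub> x \<oplus>\<^bsub>M\<^esub> \<ominus>\<^bsub>M\<^esub> (r \<odot>\<^bsub>M\<^esub> x) = \<zero>\<^bsub>M\<^esub>"
      using c x by (simp add: M.smult_l_distr M.smult_l_minus)
    then have "q \<odot>\<^bsub>M\<^esub> x = r \<odot>\<^bsub>M\<^esub> x"
      using c x M.M.add.inv_solve_right[of "\<zero>\<^bsub>M\<^esub>" "q \<odot>\<^bsub>M\<^esub> x" "r \<odot>\<^bsub>M\<^esub> x"] by simp
    then show ?thesis by (simp add: \<phi>_def q_def)
  qed
  have "\<phi> \<in> module_hom R (ideal_module R Ja) M"
  proof (rule module_homI)
    fix u assume "u \<in> carrier (ideal_module R Ja)"
    then show "\<phi> u \<in> carrier M" using \<phi> x J.Icarr by (auto simp: ideal_module_def Ja_def)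
  next
    fix u v assume "u \<in> carrier (ideal_module R Ja)" "v \<in> carrier (ideal_module R Ja)"
    then obtain r s where rs: "r \<in> J" "s \<in> J" "u = r \<otimes>\<^bsub>R\<^esub> a" "v = s \<otimes>\<^bsub>R\<^esub> a"
      by (auto simp: ideal_module_def Ja_def)
    have "u \<oplus>\<^bsub>R\<^esub> v = (r \<oplus>\<^bsub>R\<^esub> s) \<otimes>\<^bsub>R\<^esub> a" using rs a J.Icarr by (simp add: M.R.l_distr)
    then show "\<phi> (u \<oplus>\<^bsub>ideal_module R Ja\<^esub> v) = \<phi> u \<oplus>\<^bsub>M\<^esub> \<phi> v"
      using rs x J.Icarr by (simp add: ideal_module_def \<phi> M.smult_l_distr)
  next
    fix s u assume s: "s \<in> carrier R" and "u \<in> carrier (ideal_module R Ja)"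
    then obtain r where r: "r \<in> J" "u = r \<otimes>\<^bsub>R\<^esub> a"
      by (auto simp: ideal_module_def Ja_def)
    have "s \<otimes>\<^bsub>R\<^esub> u = (s \<otimes>\<^bsub>R\<^esub> r) \<otimes>\<^bsub>R\<^esub> a" using r s a J.Icarr by (simp add: M.R.m_assoc)
    then show "\<phi> (s \<odot>\<^bsub>ideal_module R Ja\<^esub> u) = s \<odot>\<^bsub>M\<^esub> \<phi> u"
      using r s x J.Icarr J.I_l_closed by (simp add: ideal_module_def \<phi> M.smult_assoc1)
  qed
  then obtain z where z: "z \<in> carrier M" "\<And>u. u \<in> Ja \<Longrightarrow> \<phi> u = u \<odot>\<^bsub>M\<^esub> z"
    using injective_module_ideal[OF inj Ja] by blast
  have "r \<odot>\<^bsub>M\<^esub> (a \<odot>\<^bsub>M\<^esub> z) = r \<odot>\<^bsub>M\<^esub> x" if r: "r \<in> J" for r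
  proof -
    have "r \<otimes>\<^bsub>R\<^esub> a \<in> Ja" using r by (auto simp: Ja_def)
    from z(2)[OF this] show ?thesis using \<phi>[OF r] r a z(1) J.Icarr by (simp add: M.smult_assoc1)
  qed
  then show ?thesis using z(1) by blast
qed

text \<open>The smallest such \<open>T\<close> is \<open>I M\<close>, so this says that \<open>I M\<close> contains every element killed by
the annihilator of \<open>I\<close>. For a single step from \<open>K\<close> to \<open>K + R a\<close>, note that
\<open>Ann (K + R a) = Ann K \<inter> Ann a\<close>: if this kills \<open>y\<close>, then there is \<open>z\<close> such that
\<open>y - a z\<close> is killed by \<open>Ann K\<close>. A maximal \<open>K \<subseteq> I\<close> with the claimed property therefore
equals \<open>I\<close>.\<close>

lemma (in noetherian_cring) annihilated_mem_submodule:
  assumes inj: "injective_module R M" and I: "ideal I R"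
    and T0: "\<zero>\<^bsub>M\<^esub> \<in> T"
    and Tadd: "\<And>x y. x \<in> T \<Longrightarrow> y \<in> T \<Longrightarrow> x \<oplus>\<^bsub>M\<^esub> y \<in> T"
    and TI: "\<And>a z. a \<in> I \<Longrightarrow> z \<in> carrier M \<Longrightarrow> a \<odot>\<^bsub>M\<^esub> z \<in> T"
    and x: "x \<in> carrier M"
    and ann: "\<And>c. c \<in> ideal_annihilator R I \<Longrightarrow> c \<odot>\<^bsub>M\<^esub> x = \<zero>\<^bsub>M\<^esub>"
  shows "x \<in> T"
proof -
  interpret M: module R M using inj by (simp add: injective_module_def)
  interpret I: ideal I R by fact
  define F where "F = {K. ideal K R \<and> K \<subseteq> I \<and>
    (\<forall>y\<in>carrier M. (\<forall>c\<in>ideal_annihilator R K. c \<odot>\<^bsub>M\<^esub> y = \<zero>\<^bsub>M\<^esub>) \<longrightarrow> y \<in> T)}"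
  have "{\<zero>} \<in> F"
    unfolding F_def
  proof (intro CollectI conjI ballI impI)
    fix y assume "y \<in> carrier M" "\<forall>c\<in>ideal_annihilator R {\<zero>}. c \<odot>\<^bsub>M\<^esub> y = \<zero>\<^bsub>M\<^esub>"
    moreover have "\<one> \<in> ideal_annihilator R {\<zero>}" by (simp add: ideal_annihilator_def)
    ultimately have "y = \<zero>\<^bsub>M\<^esub>" by (metis M.smult_one)
    then show "y \<in> T" using T0 by simp
  qed (use zeroideal I.zero_closed in auto)
  moreover have "\<And>K. K \<in> F \<Longrightarrow> ideal K R" by (simp add: F_def)
  ultimately obtain K where K: "K \<in> F" and Kmax: "\<And>Q. Q \<in> F \<Longrightarrow> K \<subseteq> Q \<Longrightarrow> Q = K"
    using exists_maximal_ideal_in[of "{\<zero>}" F] by metis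
  have Ki: "ideal K R" and KI: "K \<subseteq> I"
    and KT: "\<And>y. y \<in> carrier M \<Longrightarrow> (\<And>c. c \<in> ideal_annihilator R K \<Longrightarrow> c \<odot>\<^bsub>M\<^esub> y = \<zero>\<^bsub>M\<^esub>) \<Longrightarrow> y \<in> T"
    using K unfolding F_def by blast+
  interpret K: ideal K R by fact
  have "a \<in> K" if a: "a \<in> I" for a
  proof -
    have ac: "a \<in> carrier R" using a by (rule I.Icarr)
    define K' where "K' = {k \<oplus> r \<otimes> a | k r. k \<in> K \<and> r \<in> carrier R}"
    have "K' \<in> F"
      unfolding F_def
    proof (intro CollectI conjI ballI impI)
      show "ideal K' R" unfolding K'_def by (rule adjoin_ideal[OF Ki ac])
      show "K' \<subseteq> I"
        using KI a I.I_l_closed I.a_closed unfolding K'_def by blast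
      fix y assume y: "y \<in> carrier M" and yann: "\<forall>c\<in>ideal_annihilator R K'. c \<odot>\<^bsub>M\<^esub> y = \<zero>\<^bsub>M\<^esub>"
      have "r \<odot>\<^bsub>M\<^esub> y = \<zero>\<^bsub>M\<^esub>" if r: "r \<in> ideal_annihilator R K" "r \<otimes> a = \<zero>" for r
      proof -
        have rc: "r \<in> carrier R" and rK: "\<And>k. k \<in> K \<Longrightarrow> r \<otimes> k = \<zero>"
          using r(1) by (auto simp: ideal_annihilator_def)
        have "r \<otimes> (k \<oplus> s \<otimes> a) = \<zero>" if "k \<in> K" "s \<in> carrier R" for k s
          using that rc rK r(2) ac K.Icarr m_lcomm[of r s a] by (simp add: r_distr)
        then have "r \<in> ideal_annihilator R K'"
          using rc by (auto simp: ideal_annihilator_def K'_def)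
        then show ?thesis using yann by blast
      qed
      then obtain z where z: "z \<in> carrier M"
        and rz: "\<And>r. r \<in> ideal_annihilator R K \<Longrightarrow> r \<odot>\<^bsub>M\<^esub> (a \<odot>\<^bsub>M\<^esub> z) = r \<odot>\<^bsub>M\<^esub> y"
        using injective_module_factor[OF inj ideal_annihilator_ideal[OF Ki] ac y] by blast
      have az: "a \<odot>\<^bsub>M\<^esub> z \<in> carrier M" using ac z by simp
      define w where "w = y \<ominus>\<^bsub>M\<^esub> a \<odot>\<^bsub>M\<^esub> z"
      have wc: "w \<in> carrier M" using y az by (simp add: w_def)
      have "w \<in> T"
      proof (rule KT[OF wc])
        fix r assume r: "r \<in> ideal_annihilator R K"
        have rc: "r \<in> carrier R" using r by (simp add: ideal_annihilator_def)
        show "r \<odot>\<^bsub>M\<^esub> w = \<zero>\<^bsub>M\<^esub>"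
          using rz[OF r] rc y az
          by (simp add: w_def a_minus_def M.smult_r_distr M.smult_r_minus M.M.r_neg)
      qed
      moreover have "y = w \<oplus>\<^bsub>M\<^esub> a \<odot>\<^bsub>M\<^esub> z"
        using y az by (simp add: w_def a_minus_def M.M.a_assoc M.M.l_neg)
      ultimately show "y \<in> T" using Tadd TI[OF a z] by simp
    qed
    moreover have "K \<subseteq> K'" "a \<in> K'"
      unfolding K'_def by (rule adjoin_subset[OF Ki ac], rule adjoin_mem[OF Ki ac])
    ultimately show ?thesis using Kmax by blast
  qed
  then have "K = I" using KI by blast
  then show ?thesis using KT[OF x] ann by blast
qed

lemma generated_by_annihilator:
  fixes R :: "('a, 'r) ring_scheme" and M :: "('a, 'm, 's) module_scheme"
  assumes gen: "generated_by R I M" and I: "ideal I R"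
    and c: "c \<in> ideal_annihilator R I" and x: "x \<in> carrier M"
  shows "c \<odot>\<^bsub>M\<^esub> x = \<zero>\<^bsub>M\<^esub>"
proof -
  have M: "module R M" using gen by (simp add: generated_by_def)
  interpret M: module R M by fact
  obtain L :: "('a \<Rightarrow> 'm) set" and h where h: "h \<in> module_hom R (direct_sum_copies L (ideal_module R I)) M"
    and im: "h ` carrier (direct_sum_copies L (ideal_module R I)) = carrier M"
    using gen unfolding generated_by_def by blast
  let ?D = "direct_sum_copies L (ideal_module R I)"
  have D: "module R ?D"
    by (rule direct_sum_copies_module[OF ideal_module_module[OF M.is_cring I]])
  obtain f where f: "f \<in> carrier ?D" "x = h f" using x im by blast
  have "c \<odot>\<^bsub>?D\<^esub> f = \<zero>\<^bsub>?D\<^esub>"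
    using c f(1)
    by (auto simp: direct_sum_copies_def ideal_module_def ideal_annihilator_def intro!: restrict_ext)
  moreover have "c \<in> carrier R" using c by (simp add: ideal_annihilator_def)
  ultimately show ?thesis
    using module_homD(3)[OF h _ f(1)] module_hom_zero[OF D M h] f(2) by metis
qed

text \<open>The canonical map \<open>I\<^sup>(\<^sup>M\<^sup>) \<rightarrow> M\<close>, with one copy of \<open>I\<close> for each element \<open>l\<close> of
\<open>M\<close>, sends \<open>f\<close> to the sum of the \<open>f l \<cdot> l\<close>; its image is \<open>I M\<close>. The hypothesis
\<open>I M = M\<close> is stated without naming \<open>I M\<close>: every additively closed set that contains zero
and the products contains \<open>M\<close>.\<close>

lemma generated_by_if_products_span:
  fixes R :: "('a, 'r) ring_scheme" and M :: "('a, 'm, 's) module_scheme"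
  assumes M: "module R M" and I: "ideal I R"
    and span: "\<And>T. \<zero>\<^bsub>M\<^esub> \<in> T \<Longrightarrow> (\<And>x y. x \<in> T \<Longrightarrow> y \<in> T \<Longrightarrow> x \<oplus>\<^bsub>M\<^esub> y \<in> T) \<Longrightarrow>
      (\<And>a z. a \<in> I \<Longrightarrow> z \<in> carrier M \<Longrightarrow> a \<odot>\<^bsub>M\<^esub> z \<in> T) \<Longrightarrow> carrier M \<subseteq> T"
  shows "generated_by R I M"
proof -
  interpret M: module R M by fact
  interpret I: ideal I R by fact
  let ?D = "direct_sum_copies (carrier M) (ideal_module R I)"
  have D: "module R ?D"
    by (rule direct_sum_copies_module[OF ideal_module_module[OF M.is_cring I]])
  interpret D: module R ?D by fact
  define supp where "supp f = {l \<in> carrier M. f l \<noteq> \<zero>\<^bsub>R\<^esub>}" for f :: "'m \<Rightarrow> 'a"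
  define h where "h f = (\<Oplus>\<^bsub>M\<^esub>l\<in>supp f. f l \<odot>\<^bsub>M\<^esub> l)" for f
  have mem: "f \<in> carrier ?D \<longleftrightarrow> f \<in> carrier M \<rightarrow>\<^sub>E I \<and> finite (supp f)" for f
    by (simp add: direct_sum_copies_def ideal_module_def supp_def)
  have val: "f l \<in> carrier R" if "f \<in> carrier ?D" "l \<in> carrier M" for f l
    using that mem I.Icarr by blast
  have h_eq: "h f = (\<Oplus>\<^bsub>M\<^esub>l\<in>A. f l \<odot>\<^bsub>M\<^esub> l)"
    if f: "f \<in> carrier ?D" and A: "finite A" "supp f \<subseteq> A" "A \<subseteq> carrier M" for f A
    unfolding h_def
  proof (rule M.M.add.finprod_mono_neutral_cong_left[OF A(1,2)])
    show "(\<lambda>l. f l \<odot>\<^bsub>M\<^esub> l) \<in> A \<rightarrow> carrier M" using val[OF f] A(3) by auto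
    show "f i \<odot>\<^bsub>M\<^esub> i = \<zero>\<^bsub>M\<^esub>" if "i \<in> A - supp f" for i
      using that A(3) by (auto simp: supp_def)
  qed simp
  have h: "h \<in> module_hom R ?D M"
  proof (rule module_homI)
    fix f assume f: "f \<in> carrier ?D"
    have "(\<lambda>l. f l \<odot>\<^bsub>M\<^esub> l) \<in> supp f \<rightarrow> carrier M"
      using val[OF f] by (auto simp: supp_def)
    then show "h f \<in> carrier M"
      unfolding h_def by (rule M.M.finsum_closed)
  next
    fix f g assume fg: "f \<in> carrier ?D" "g \<in> carrier ?D"
    let ?A = "supp f \<union> supp g"
    have A: "finite ?A" "?A \<subseteq> carrier M" using fg mem by (auto simp: supp_def)
    have fgD: "f \<oplus>\<^bsub>?D\<^esub> g \<in> carrier ?D" using fg by simp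
    have e: "(f \<oplus>\<^bsub>?D\<^esub> g) l = f l \<oplus>\<^bsub>R\<^esub> g l" if "l \<in> carrier M" for l
      using that by (simp add: direct_sum_copies_def ideal_module_def)
    have s: "supp (f \<oplus>\<^bsub>?D\<^esub> g) \<subseteq> ?A" using e by (auto simp: supp_def)
    have "h (f \<oplus>\<^bsub>?D\<^esub> g) = (\<Oplus>\<^bsub>M\<^esub>l\<in>?A. (f \<oplus>\<^bsub>?D\<^esub> g) l \<odot>\<^bsub>M\<^esub> l)"
      by (rule h_eq[OF fgD A(1) s A(2)])
    also have "\<dots> = (\<Oplus>\<^bsub>M\<^esub>l\<in>?A. f l \<odot>\<^bsub>M\<^esub> l \<oplus>\<^bsub>M\<^esub> g l \<odot>\<^bsub>M\<^esub> l)"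
      by (rule M.M.finsum_cong')
        (use A(2) e val[OF fg(1)] val[OF fg(2)] in \<open>auto simp: M.smult_l_distr subset_iff\<close>)
    also have "\<dots> = (\<Oplus>\<^bsub>M\<^esub>l\<in>?A. f l \<odot>\<^bsub>M\<^esub> l) \<oplus>\<^bsub>M\<^esub> (\<Oplus>\<^bsub>M\<^esub>l\<in>?A. g l \<odot>\<^bsub>M\<^esub> l)"
      by (rule M.M.finsum_addf) (use A(2) val[OF fg(1)] val[OF fg(2)] in auto)
    also have "\<dots> = h f \<oplus>\<^bsub>M\<^esub> h g"
      using h_eq[OF fg(1) A(1) _ A(2)] h_eq[OF fg(2) A(1) _ A(2)] by simp
    finally show "h (f \<oplus>\<^bsub>?D\<^esub> g) = h f \<oplus>\<^bsub>M\<^esub> h g" .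
  next
    fix r f assume r: "r \<in> carrier R" and f: "f \<in> carrier ?D"
    have A: "finite (supp f)" "supp f \<subseteq> carrier M" using f mem by (auto simp: supp_def)
    have e: "(r \<odot>\<^bsub>?D\<^esub> f) l = r \<otimes>\<^bsub>R\<^esub> f l" if "l \<in> carrier M" for l
      using that by (simp add: direct_sum_copies_def ideal_module_def)
    have s: "supp (r \<odot>\<^bsub>?D\<^esub> f) \<subseteq> supp f" using e r by (auto simp: supp_def)
    have "h (r \<odot>\<^bsub>?D\<^esub> f) = (\<Oplus>\<^bsub>M\<^esub>l\<in>supp f. (r \<odot>\<^bsub>?D\<^esub> f) l \<odot>\<^bsub>M\<^esub> l)"
      by (rule h_eq[OF _ A(1) s A(2)]) (use r f in simp)
    also have "\<dots> = (\<Oplus>\<^bsub>M\<^esub>l\<in>supp f. r \<odot>\<^bsub>M\<^esub> (f l \<odot>\<^bsub>M\<^esub> l))"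
      by (rule M.M.finsum_cong')
        (use A(2) e r val[OF f] in \<open>auto simp: M.smult_assoc1 subset_iff\<close>)
    also have "\<dots> = r \<odot>\<^bsub>M\<^esub> h f"
      unfolding h_def
      by (rule M.finsum_smult_ldistr[symmetric]) (use A r val[OF f] in auto)
    finally show "h (r \<odot>\<^bsub>?D\<^esub> f) = r \<odot>\<^bsub>M\<^esub> h f" .
  qed
  have "carrier M \<subseteq> h ` carrier ?D"
  proof (rule span)
    show "\<zero>\<^bsub>M\<^esub> \<in> h ` carrier ?D"
      using module_hom_zero[OF D M h] D.M.zero_closed by (metis imageI)
  next
    fix x y assume "x \<in> h ` carrier ?D" "y \<in> h ` carrier ?D"
    then show "x \<oplus>\<^bsub>M\<^esub> y \<in> h ` carrier ?D"
      using D.M.a_closed by (auto simp flip: module_homD(2)[OF h])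
  next
    fix a z assume a: "a \<in> I" and z: "z \<in> carrier M"
    define f where "f = (\<lambda>l\<in>carrier M. if l = z then a else \<zero>\<^bsub>R\<^esub>)"
    have s: "supp f \<subseteq> {z}" by (auto simp: supp_def f_def)
    then have "finite (supp f)" by (rule finite_subset) simp
    then have f: "f \<in> carrier ?D" using a by (auto simp: mem f_def)
    have "h f = a \<odot>\<^bsub>M\<^esub> z"
      using h_eq[OF f _ s] z a I.Icarr by (simp add: f_def)
    then show "a \<odot>\<^bsub>M\<^esub> z \<in> h ` carrier ?D" using f by (metis imageI)
  qed
  then have "h ` carrier ?D = carrier M" using module_homD(1)[OF h] by blast
  then show ?thesis by (rule generated_by_of_surjection[OF M I h])
qed

lemma (in noetherian_cring) generated_by_iff_annihilated:
  assumes inj: "injective_module R M" and I: "ideal I R"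
  shows "generated_by R I M \<longleftrightarrow>
    (\<forall>c\<in>ideal_annihilator R I. \<forall>x\<in>carrier M. c \<odot>\<^bsub>M\<^esub> x = \<zero>\<^bsub>M\<^esub>)"
proof
  assume "generated_by R I M"
  then show "\<forall>c\<in>ideal_annihilator R I. \<forall>x\<in>carrier M. c \<odot>\<^bsub>M\<^esub> x = \<zero>\<^bsub>M\<^esub>"
    by (intro ballI) (rule generated_by_annihilator[OF _ I])
next
  assume ann: "\<forall>c\<in>ideal_annihilator R I. \<forall>x\<in>carrier M. c \<odot>\<^bsub>M\<^esub> x = \<zero>\<^bsub>M\<^esub>"
  have "module R M" using inj by (simp add: injective_module_def)
  then show "generated_by R I M"
  proof (rule generated_by_if_products_span[OF _ I])
    fix T assume "\<zero>\<^bsub>M\<^esub> \<in> T" "\<And>x y. x \<in> T \<Longrightarrow> y \<in> T \<Longrightarrow> x \<oplus>\<^bsub>M\<^esub> y \<in> T"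
      "\<And>a z. a \<in> I \<Longrightarrow> z \<in> carrier M \<Longrightarrow> a \<odot>\<^bsub>M\<^esub> z \<in> T"
    then show "carrier M \<subseteq> T"
      by (intro subsetI, rule annihilated_mem_submodule[OF inj I]) (simp_all add: ann)
  qed
qed


section \<open>Local conditions at the associated primes\<close>

text \<open>With \<open>N = Ann w\<close>, the annihilator of \<open>s w\<close> is \<open>(N : s)\<close>, so a maximal ideal quotient of
\<open>N\<close> is an associated prime of \<open>M\<close>.\<close>

lemma (in noetherian_cring) associated_prime_of_multiple:
  assumes M: "module R M" and w: "w \<in> carrier M" "w \<noteq> \<zero>\<^bsub>M\<^esub>"
  obtains s where "s \<in> carrier R" "annihilator R M (s \<odot>\<^bsub>M\<^esub> w) \<in> Ass R M"
proof -
  interpret M: module R M by fact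
  define N where "N = annihilator R M w"
  have N: "ideal N R"
    by (rule ideal_by_closure)
      (use w(1) in \<open>auto simp: N_def annihilator_def M.smult_l_distr M.smult_assoc1\<close>)
  have one: "\<one> \<in> carrier R - N" using w by (simp add: N_def annihilator_def)
  obtain s where s: "s \<in> carrier R - N"
    "\<And>v. v \<in> carrier R - N \<Longrightarrow> colon R N s \<subseteq> colon R N v \<Longrightarrow> colon R N v = colon R N s"
    using maximal_colon_above[OF N one] by auto
  have "colon R N s = annihilator R M (s \<odot>\<^bsub>M\<^esub> w)"
    using s(1) w(1) by (auto simp: colon_def N_def annihilator_def M.smult_assoc1)
  then have "primeideal (annihilator R M (s \<odot>\<^bsub>M\<^esub> w)) R"
    using maximal_colon_prime[OF N s(1)] s(2) by simp
  then show ?thesis using that[of s] s(1) w(1) by (auto simp: Ass_def)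
qed

text \<open>The right-hand side says that \<open>c/1 = 0\<close> in \<open>R\<^sub>p\<close> for all associated primes \<open>p\<close> of
\<open>M\<close>. Injectivity is what makes it necessary: where \<open>c/1 \<noteq> 0\<close>, the element \<open>x\<close> with
annihilator \<open>p\<close> is divisible by \<open>c\<close>.\<close>

lemma (in noetherian_cring) annihilated_iff_locally_zero:
  assumes inj: "injective_module R M" and c: "c \<in> carrier R"
  shows "(\<forall>x\<in>carrier M. c \<odot>\<^bsub>M\<^esub> x = \<zero>\<^bsub>M\<^esub>) \<longleftrightarrow>
    (\<forall>p\<in>Ass R M. \<exists>u\<in>carrier R - p. u \<otimes> c = \<zero>)"
proof -
  have M: "module R M" using inj by (simp add: injective_module_def)
  interpret M: module R M by fact
  show ?thesis
  proof
    assume cM: "\<forall>x\<in>carrier M. c \<odot>\<^bsub>M\<^esub> x = \<zero>\<^bsub>M\<^esub>"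
    show "\<forall>p\<in>Ass R M. \<exists>u\<in>carrier R - p. u \<otimes> c = \<zero>"
    proof (rule ballI, rule ccontr)
      fix p assume "p \<in> Ass R M" and no: "\<not> (\<exists>u\<in>carrier R - p. u \<otimes> c = \<zero>)"
      then obtain x where x: "x \<in> carrier M" "p = annihilator R M x" and p: "primeideal p R"
        by (auto simp: Ass_def)
      have "\<exists>z\<in>carrier M. \<forall>r\<in>carrier R. r \<odot>\<^bsub>M\<^esub> (c \<odot>\<^bsub>M\<^esub> z) = r \<odot>\<^bsub>M\<^esub> x"
        using no x by (intro injective_module_factor[OF inj oneideal c]) (auto simp: annihilator_def)
      then obtain z where "z \<in> carrier M" "\<one> \<odot>\<^bsub>M\<^esub> (c \<odot>\<^bsub>M\<^esub> z) = \<one> \<odot>\<^bsub>M\<^esub> x"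
        using one_closed by blast
      then have "x = \<zero>\<^bsub>M\<^esub>" using cM x(1) c by simp
      then have "p = carrier R" using x(2) by (auto simp: annihilator_def)
      then show False using primeideal.I_notcarr[OF p] by simp
    qed
  next
    assume loc: "\<forall>p\<in>Ass R M. \<exists>u\<in>carrier R - p. u \<otimes> c = \<zero>"
    show "\<forall>x\<in>carrier M. c \<odot>\<^bsub>M\<^esub> x = \<zero>\<^bsub>M\<^esub>"
    proof (rule ballI, rule ccontr)
      fix x assume x: "x \<in> carrier M" and cx: "c \<odot>\<^bsub>M\<^esub> x \<noteq> \<zero>\<^bsub>M\<^esub>"
      then obtain s where s: "s \<in> carrier R"
        and A: "annihilator R M (s \<odot>\<^bsub>M\<^esub> (c \<odot>\<^bsub>M\<^esub> x)) \<in> Ass R M"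
        using associated_prime_of_multiple[OF M _ cx] c by blast
      then obtain u where u: "u \<in> carrier R" "u \<otimes> c = \<zero>"
        "u \<notin> annihilator R M (s \<odot>\<^bsub>M\<^esub> (c \<odot>\<^bsub>M\<^esub> x))" using loc by blast
      have "u \<odot>\<^bsub>M\<^esub> (s \<odot>\<^bsub>M\<^esub> (c \<odot>\<^bsub>M\<^esub> x)) = s \<odot>\<^bsub>M\<^esub> ((u \<otimes> c) \<odot>\<^bsub>M\<^esub> x)"
        using u(1) s c x by (simp add: M.smult_assoc1[symmetric] m_ac)
      also have "\<dots> = \<zero>\<^bsub>M\<^esub>" using u(2) s x by simp
      finally show False using u(1,3) by (simp add: annihilator_def)
    qed
  qed
qed

lemma complement_submonoid:
  assumes "primeideal p R"
  shows "submonoid (carrier R - p) R"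
proof -
  interpret primeideal p R by fact
  show ?thesis
    by (rule submonoid.intro) (use I_prime one_imp_carrier I_notcarr in auto)
qed

lemma frac_eq_zero_iff:
  assumes R: "cring R" and S: "submonoid S R" and a: "a \<in> carrier R" and s: "s \<in> S"
  shows "frac R S a s = \<zero>\<^bsub>localization R S\<^esub> \<longleftrightarrow> (\<exists>u\<in>S. u \<otimes>\<^bsub>R\<^esub> a = \<zero>\<^bsub>R\<^esub>)"
proof -
  interpret cring R by fact
  have "S \<subseteq> carrier R" "\<one>\<^bsub>R\<^esub> \<in> S"
    using S by (simp_all add: submonoid.subset submonoid.one_closed)
  then have "frac R S a s = frac R S \<zero>\<^bsub>R\<^esub> \<one>\<^bsub>R\<^esub> \<longleftrightarrow> (\<exists>u\<in>S. u \<otimes>\<^bsub>R\<^esub> a = \<zero>\<^bsub>R\<^esub>)"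
    using frac_eq_iff[OF R S a s zero_closed, of "\<one>\<^bsub>R\<^esub>"] a s
    by (simp add: subset_iff cong: bex_cong_simp)
  then show ?thesis by (simp add: localization_def)
qed

lemma localized_ideal_fractions:
  assumes R: "cring R" and S: "submonoid S R" and I: "ideal I R"
    and y: "y \<in> genideal (localization R S) ((\<lambda>a. frac R S a \<one>\<^bsub>R\<^esub>) ` I)"
  obtains a s where "a \<in> I" "s \<in> S" "y = frac R S a s"
proof -
  interpret cring R by fact
  interpret I: ideal I R by fact
  interpret L: cring "localization R S" by (rule localization_cring[OF R S])
  have one: "\<one>\<^bsub>R\<^esub> \<in> S" and sub: "\<And>s. s \<in> S \<Longrightarrow> s \<in> carrier R"
    and mc: "\<And>s t. s \<in> S \<Longrightarrow> t \<in> S \<Longrightarrow> s \<otimes>\<^bsub>R\<^esub> t \<in> S"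
    using submonoid.one_closed[OF S] submonoid.subset[OF S] submonoid.m_closed[OF S] by blast+
  define E where "E = {frac R S a s | a s. a \<in> I \<and> s \<in> S}"
  have "ideal E (localization R S)"
  proof (rule L.ideal_by_closure)
    show "E \<subseteq> carrier (localization R S)"
      using I.Icarr by (auto simp: E_def intro: frac_carrier)
    have "\<zero>\<^bsub>localization R S\<^esub> = frac R S \<zero>\<^bsub>R\<^esub> \<one>\<^bsub>R\<^esub>" by (simp add: localization_def)
    then show "\<zero>\<^bsub>localization R S\<^esub> \<in> E"
      using one I.zero_closed unfolding E_def by blast
  next
    fix X Y assume "X \<in> E" "Y \<in> E"
    then obtain a s b t where *: "a \<in> I" "s \<in> S" "b \<in> I" "t \<in> S"
      "X = frac R S a s" "Y = frac R S b t" by (auto simp: E_def)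
    have "X \<oplus>\<^bsub>localization R S\<^esub> Y = frac R S (t \<otimes>\<^bsub>R\<^esub> a \<oplus>\<^bsub>R\<^esub> s \<otimes>\<^bsub>R\<^esub> b) (s \<otimes>\<^bsub>R\<^esub> t)"
      using * I.Icarr by (simp add: frac_add[OF R S])
    moreover have "t \<otimes>\<^bsub>R\<^esub> a \<oplus>\<^bsub>R\<^esub> s \<otimes>\<^bsub>R\<^esub> b \<in> I"
      using * sub by (intro I.a_closed I.I_l_closed) auto
    ultimately show "X \<oplus>\<^bsub>localization R S\<^esub> Y \<in> E" using * mc unfolding E_def by blast
  next
    fix Z X assume "Z \<in> carrier (localization R S)" "X \<in> E"
    then obtain a s b t where *: "b \<in> carrier R" "t \<in> S" "Z = frac R S b t"
      "a \<in> I" "s \<in> S" "X = frac R S a s"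
      by (auto simp: E_def elim!: localization_cases)
    have "Z \<otimes>\<^bsub>localization R S\<^esub> X = frac R S (b \<otimes>\<^bsub>R\<^esub> a) (t \<otimes>\<^bsub>R\<^esub> s)"
      using * I.Icarr by (simp add: frac_mult[OF R S])
    then show "Z \<otimes>\<^bsub>localization R S\<^esub> X \<in> E" using * mc I.I_l_closed unfolding E_def by blast
  qed
  moreover have "(\<lambda>a. frac R S a \<one>\<^bsub>R\<^esub>) ` I \<subseteq> E" using one by (auto simp: E_def)
  ultimately have "y \<in> E" using y L.genideal_minimal by blast
  then show ?thesis using that by (auto simp: E_def)
qed

text \<open>Over a finite set of generators of \<open>I\<close> one would multiply the denominators. Here the ideal
of all \<open>b \<in> I\<close> with \<open>u b y = 0\<close> is made maximal by the choice of \<open>u\<close>; it grows when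
\<open>u\<close> is multiplied by a witness for a further \<open>b\<close>.\<close>

lemma (in noetherian_cring) common_torsion_witness:
  assumes S: "submonoid S R" and I: "ideal I R" and y: "y \<in> carrier R"
    and tors: "\<And>b. b \<in> I \<Longrightarrow> \<exists>u\<in>S. u \<otimes> (b \<otimes> y) = \<zero>"
  obtains u where "u \<in> S" "\<And>b. b \<in> I \<Longrightarrow> u \<otimes> (b \<otimes> y) = \<zero>"
proof -
  interpret I: ideal I R by fact
  have one: "\<one> \<in> S" and sub: "\<And>s. s \<in> S \<Longrightarrow> s \<in> carrier R"
    and mc: "\<And>s t. s \<in> S \<Longrightarrow> t \<in> S \<Longrightarrow> s \<otimes> t \<in> S"
    using submonoid.one_closed[OF S] submonoid.subset[OF S] submonoid.m_closed[OF S] by blast+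
  define B where "B u = {b \<in> I. u \<otimes> (b \<otimes> y) = \<zero>}" for u
  have "ideal (B u) R" if "u \<in> S" for u
    using sub[OF that] y
    by (intro ideal_by_closure)
      (auto simp: B_def I.Icarr I.I_l_closed l_distr r_distr m_assoc m_lcomm[of u])
  then have "\<exists>P\<in>B ` S. B \<one> \<subseteq> P \<and> (\<forall>Q\<in>B ` S. P \<subseteq> Q \<longrightarrow> Q = P)"
    using one by (intro exists_maximal_ideal_in) auto
  then obtain u where u: "u \<in> S" and max: "\<And>v. v \<in> S \<Longrightarrow> B u \<subseteq> B v \<Longrightarrow> B v = B u"
    by auto
  have "u \<otimes> (b \<otimes> y) = \<zero>" if b: "b \<in> I" for b
  proof -
    obtain v where v: "v \<in> S" "v \<otimes> (b \<otimes> y) = \<zero>" using tors[OF b] by blast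
    have e1: "v \<otimes> u \<otimes> (c \<otimes> y) = v \<otimes> (u \<otimes> (c \<otimes> y))"
      and e2: "v \<otimes> u \<otimes> (c \<otimes> y) = u \<otimes> (v \<otimes> (c \<otimes> y))" if "c \<in> I" for c
      using sub[OF u] sub[OF v(1)] I.Icarr[OF that] y by (simp_all add: m_ac)
    have "B u \<subseteq> B (v \<otimes> u)" using e1 sub[OF v(1)] by (auto simp: B_def)
    then have "B (v \<otimes> u) = B u" by (rule max[OF mc[OF v(1) u]])
    moreover have "b \<in> B (v \<otimes> u)" using e2[OF b] v b sub[OF u] by (simp add: B_def)
    ultimately show ?thesis by (simp add: B_def)
  qed
  then show ?thesis using that u by blast
qed

text \<open>This ideal is the kernel of the localization map.\<close>

lemma (in cring) torsion_ideal:
  assumes S: "submonoid S R"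
  shows "ideal {y \<in> carrier R. \<exists>u\<in>S. u \<otimes> y = \<zero>} R"
proof -
  define N where "N = {y \<in> carrier R. \<exists>u\<in>S. u \<otimes> y = \<zero>}"
  have one: "\<one> \<in> S" and sub: "\<And>s. s \<in> S \<Longrightarrow> s \<in> carrier R"
    and mc: "\<And>s t. s \<in> S \<Longrightarrow> t \<in> S \<Longrightarrow> s \<otimes> t \<in> S"
    using submonoid.one_closed[OF S] submonoid.subset[OF S] submonoid.m_closed[OF S] by blast+
  have "ideal N R"
  proof (rule ideal_by_closure)
    show "N \<subseteq> carrier R" by (auto simp: N_def)
    show "\<zero> \<in> N" using one r_null[OF one_closed] zero_closed unfolding N_def by blast
  next
    fix x y assume "x \<in> N" "y \<in> N"
    then obtain u v where *: "x \<in> carrier R" "y \<in> carrier R" "u \<in> S" "v \<in> S"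
      "u \<otimes> x = \<zero>" "v \<otimes> y = \<zero>" by (auto simp: N_def)
    have "(u \<otimes> v) \<otimes> (x \<oplus> y) = v \<otimes> (u \<otimes> x) \<oplus> u \<otimes> (v \<otimes> y)"
      using *(1,2) sub[OF *(3)] sub[OF *(4)] by (simp add: r_distr m_ac)
    then have "(u \<otimes> v) \<otimes> (x \<oplus> y) = \<zero>" using * sub by simp
    then show "x \<oplus> y \<in> N" using * mc unfolding N_def by blast
  next
    fix r x assume r: "r \<in> carrier R" and "x \<in> N"
    then obtain u where *: "x \<in> carrier R" "u \<in> S" "u \<otimes> x = \<zero>" by (auto simp: N_def)
    have "u \<otimes> (r \<otimes> x) = r \<otimes> (u \<otimes> x)"
      using *(1) r sub[OF *(2)] by (simp add: m_lcomm)
    then have "u \<otimes> (r \<otimes> x) = \<zero>" using * r by simp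
    then show "r \<otimes> x \<in> N" using * r unfolding N_def by blast
  qed
  then show ?thesis by (simp add: N_def)
qed

text \<open>A non-zero-divisor \<open>a/s\<close> with \<open>a \<in> I\<close> annihilates \<open>c/1\<close> for all \<open>c\<close> in the
annihilator \<open>J\<close> of \<open>I\<close>, which forces \<open>J\<^sub>p = 0\<close>. For the converse let \<open>N\<close> be the kernel
of \<open>R \<rightarrow> R\<^sub>p\<close>. If \<open>I y \<subseteq> N\<close>, one denominator \<open>u\<close> gives \<open>u I y = 0\<close>, so
\<open>u y \<in> J \<subseteq> N\<close> and \<open>y \<in> N\<close>. Hence \<open>I\<close> contains a non-zero-divisor modulo \<open>N\<close>, and
this is a non-zero-divisor in \<open>R\<^sub>p\<close>.\<close>

lemma (in noetherian_cring) regular_localization_iff: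
  assumes p: "primeideal p R" and I: "ideal I R"
  shows "regular_ideal (localize_at R p) (localize_ideal_at R p I) \<longleftrightarrow>
    (\<forall>c\<in>ideal_annihilator R I. \<exists>u\<in>carrier R - p. u \<otimes> c = \<zero>)"
proof -
  define S where "S = carrier R - p"
  have S: "submonoid S R" unfolding S_def by (rule complement_submonoid[OF p])
  have one: "\<one> \<in> S" and sub: "\<And>s. s \<in> S \<Longrightarrow> s \<in> carrier R"
    and mc: "\<And>s t. s \<in> S \<Longrightarrow> t \<in> S \<Longrightarrow> s \<otimes> t \<in> S"
    using submonoid.one_closed[OF S] submonoid.subset[OF S] submonoid.m_closed[OF S] by blast+
  define L where "L = localization R S"
  interpret L: cring L unfolding L_def by (rule localization_cring[OF is_cring S])
  interpret I: ideal I R by fact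
  define gens where "gens = (\<lambda>a. frac R S a \<one>) ` I"
  have gens: "gens \<subseteq> carrier L"
    using one I.Icarr by (auto simp: gens_def L_def intro: frac_carrier)
  have zero_iff: "frac R S a s = \<zero>\<^bsub>L\<^esub> \<longleftrightarrow> (\<exists>u\<in>S. u \<otimes> a = \<zero>)" if "a \<in> carrier R" "s \<in> S" for a s
    unfolding L_def by (rule frac_eq_zero_iff[OF is_cring S that])
  have "regular_ideal L (genideal L gens) \<longleftrightarrow>
    (\<forall>c\<in>ideal_annihilator R I. \<exists>u\<in>S. u \<otimes> c = \<zero>)"
  proof
    assume "regular_ideal L (genideal L gens)"
    then obtain y where y: "y \<in> genideal L gens" and nzd: "non_zero_divisor L y"
      by (auto simp: regular_ideal_def)
    obtain a s where as: "a \<in> I" "s \<in> S" "y = frac R S a s"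
      using localized_ideal_fractions[OF is_cring S I] y unfolding L_def gens_def by blast
    show "\<forall>c\<in>ideal_annihilator R I. \<exists>u\<in>S. u \<otimes> c = \<zero>"
    proof
      fix c assume "c \<in> ideal_annihilator R I"
      then have c: "c \<in> carrier R" "c \<otimes> a = \<zero>" using as(1) by (auto simp: ideal_annihilator_def)
      have ac: "a \<in> carrier R" using as(1) by (rule I.Icarr)
      have "y \<otimes>\<^bsub>L\<^esub> frac R S c \<one> = frac R S (a \<otimes> c) (s \<otimes> \<one>)"
        unfolding L_def as(3) by (rule frac_mult[OF is_cring S ac as(2) c(1) one])
      also have "a \<otimes> c = \<zero>" using c ac by (simp add: m_comm)
      also have "frac R S \<zero> (s \<otimes> \<one>) = \<zero>\<^bsub>L\<^esub>"
        using zero_iff[OF zero_closed mc[OF as(2) one]] one r_null[OF one_closed] by blast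
      finally have "frac R S c \<one> = \<zero>\<^bsub>L\<^esub>"
        using nzd frac_carrier[of c R \<one> S] c(1) one unfolding non_zero_divisor_def L_def by blast
      then show "\<exists>u\<in>S. u \<otimes> c = \<zero>" using zero_iff[OF c(1) one] by simp
    qed
  next
    assume ann: "\<forall>c\<in>ideal_annihilator R I. \<exists>u\<in>S. u \<otimes> c = \<zero>"
    define N where "N = {y \<in> carrier R. \<exists>u\<in>S. u \<otimes> y = \<zero>}"
    have N: "ideal N R" unfolding N_def by (rule torsion_ideal[OF S])
    have "y \<in> N" if y: "y \<in> carrier R" and yN: "\<And>b. b \<in> I \<Longrightarrow> b \<otimes> y \<in> N" for y
    proof -
      have "\<And>b. b \<in> I \<Longrightarrow> \<exists>u\<in>S. u \<otimes> (b \<otimes> y) = \<zero>" using yN by (auto simp: N_def)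
      then obtain u where u: "u \<in> S" "\<And>b. b \<in> I \<Longrightarrow> u \<otimes> (b \<otimes> y) = \<zero>"
        using common_torsion_witness[OF S I y] by blast
      have "u \<otimes> y \<in> ideal_annihilator R I"
        using u sub[OF u(1)] y I.Icarr by (auto simp: ideal_annihilator_def m_assoc m_comm[of y])
      then obtain v where v: "v \<in> S" "v \<otimes> (u \<otimes> y) = \<zero>" using ann by blast
      then have "(v \<otimes> u) \<otimes> y = \<zero>" using sub[OF u(1)] sub[OF v(1)] y by (simp add: m_assoc)
      then show ?thesis using y mc[OF v(1) u(1)] unfolding N_def by blast
    qed
    then obtain a where a: "a \<in> I" and aN: "\<And>y. y \<in> carrier R \<Longrightarrow> a \<otimes> y \<in> N \<Longrightarrow> y \<in> N"
      using exists_nonzerodivisor_mod[OF N I] by blast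
    have ac: "a \<in> carrier R" using a by (rule I.Icarr)
    have "non_zero_divisor L (frac R S a \<one>)"
      unfolding non_zero_divisor_def
    proof (intro conjI ballI impI)
      show "frac R S a \<one> \<in> carrier L" using ac one by (simp add: L_def frac_carrier)
      fix Y assume "Y \<in> carrier L" and 0: "frac R S a \<one> \<otimes>\<^bsub>L\<^esub> Y = \<zero>\<^bsub>L\<^esub>"
      then obtain b t where bt: "b \<in> carrier R" "t \<in> S" "Y = frac R S b t"
        unfolding L_def by (elim localization_cases)
      have "frac R S (a \<otimes> b) (\<one> \<otimes> t) = \<zero>\<^bsub>L\<^esub>"
        using 0 frac_mult[OF is_cring S ac one bt(1,2)] bt(3) by (simp add: L_def)
      then have "a \<otimes> b \<in> N" using zero_iff[OF m_closed[OF ac bt(1)] mc[OF one bt(2)]] ac bt(1)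
        by (simp add: N_def)
      then have "b \<in> N" using aN bt(1) by blast
      then show "Y = \<zero>\<^bsub>L\<^esub>" using zero_iff[OF bt(1,2)] bt(3) by (simp add: N_def)
    qed
    moreover have "frac R S a \<one> \<in> genideal L gens"
      using L.genideal_self[OF gens] a by (auto simp: gens_def)
    ultimately show "regular_ideal L (genideal L gens)"
      using L.genideal_ideal[OF gens] unfolding regular_ideal_def by blast
  qed
  then show ?thesis
    by (simp add: localize_at_def localize_ideal_at_def S_def L_def gens_def)
qed

theorem mainTheorem2:
  fixes R :: "('a, 'r) ring_scheme" and m I :: "'a set" and M :: "('a, 'm) module"
  assumes "noetherian_ring R" and "local_ring R m"
    and "ideal I R"
    and "injective_module R M"
  shows "generated_by R I M \<longleftrightarrow>
    (\<forall>p \<in> Ass R M. regular_ideal (localize_at R p) (localize_ideal_at R p I))"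
proof -
  interpret noetherian_cring R
    using assms(1,2) by (simp add: noetherian_cring_def local_ring_def)
  have "generated_by R I M \<longleftrightarrow>
      (\<forall>c\<in>ideal_annihilator R I. \<forall>x\<in>carrier M. c \<odot>\<^bsub>M\<^esub> x = \<zero>\<^bsub>M\<^esub>)"
    by (rule generated_by_iff_annihilated[OF assms(4,3)])
  also have "\<dots> \<longleftrightarrow>
      (\<forall>c\<in>ideal_annihilator R I. \<forall>p\<in>Ass R M. \<exists>u\<in>carrier R - p. u \<otimes>\<^bsub>R\<^esub> c = \<zero>\<^bsub>R\<^esub>)"
    by (rule ball_cong[OF refl], rule annihilated_iff_locally_zero[OF assms(4)])
      (simp add: ideal_annihilator_def)
  also have "\<dots> \<longleftrightarrow>
      (\<forall>p\<in>Ass R M. \<forall>c\<in>ideal_annihilator R I. \<exists>u\<in>carrier R - p. u \<otimes>\<^bsub>R\<^esub> c = \<zero>\<^bsub>R\<^esub>)"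
    by blast
  also have "\<dots> \<longleftrightarrow>
      (\<forall>p\<in>Ass R M. regular_ideal (localize_at R p) (localize_ideal_at R p I))"
    by (rule ball_cong[OF refl], rule regular_localization_iff[OF _ assms(3), symmetric])
      (simp add: Ass_def)
  finally show ?thesis .
qed

end
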